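(* In the linear oblivious setting described in the context, suppose $[T]$ is partitioned into $m$ disjoint nonempty sets $I_1,\dots,I_m$ with $|I_u|=T_u$ such that $\{x_t: t\in I_u\}$ lies in a linear subspace of $\mathbb{R}^d$ of dimension $d_u$. Run QuFUR$(\alpha)$ with inputs $d,T,C,\eta,\alpha$. Then with probability at least $1-\delta$: 1. its query complexity satisfies $Q=\tilde O\big(\sum_{u=1}^m \min\{T_u,\ \tilde\eta\sqrt{\alpha d_u T_u}\}+1\big)$; 2. its regret satisfies $R=\tilde O\big(\sum_{u=1}^m \max\{\tilde\eta^2 d_u,\ \tilde\eta\sqrt{d_uT_u/\alpha}\}\big)$.
   Context: Linear oblivious setting: fix integers $d,T\ge 1$, reals $C>0$, $\eta\ge 0$, $\delta\in(0,1)$, and let $\tilde\eta=\max\{1,\eta\}$. An unknown $\theta^*\in\mathbb{R}^d$ with $\|\theta^*\|_2\le C$ and a sequence $x_1,\dots,x_T\in\mathbb{R}^d$ with $\|x_t\|_2\le 1$ and $|\langle\theta^*,x_t\rangle|\le 1$ are fixed before the interaction (oblivious adversary). Labels are $y_t=\langle\theta^*,x_t\rangle+\xi_t$, where the $\xi_t$ are independent zero-mean sub-Gaussian random variables with variance proxy $\eta^2$, independent of the learner's internal randomness. At each round $t=1,\dots,T$ the learner sees $x_t$, predicts $\hat y_t\in[-1,1]$, then chooses $q_t\in\{0,1\}$; if $q_t=1$ it observes $y_t$. Query complexity: $Q=\sum_{t=1}^T q_t$. Regret: $R=\sum_{t=1}^T(\hat y_t-\langle\theta^*,x_t\rangle)^2$.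 Notation: $\mathrm{clip}(z)=\min(1,\max(-1,z))$; $\|v\|_M=\sqrt{v^\top M v}$. $\tilde O(\cdot)$ hides absolute constants and factors polylogarithmic in $T$, $1/\delta$ and $C$. Algorithm QuFUR$(\alpha)$ (parameter $\alpha>0$): initialize $M\leftarrow C^{-2}I_d$ and queried set $\mathcal{Q}\leftarrow\emptyset$. For each $t$: let $M_t$ be the current $M$; set $\hat\theta_t=M_t^{-1}\sum_{s\in\mathcal{Q}}x_s y_s$; predict $\hat y_t=\mathrm{clip}(\langle\hat\theta_t,x_t\rangle)$; set $\Delta_t=\tilde\eta^2\min\{1,\|x_t\|^2_{M_t^{-1}}\}$; independently set $q_t=1$ with probability $\min\{1,\alpha\Delta_t\}$ and $q_t=0$ otherwise; if $q_t=1$, observe $y_t$, update $M\leftarrow M+x_tx_t^\top$ and $\mathcal{Q}\leftarrow\mathcal{Q}\cup\{t\}$. *)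

theory Defs
  imports "HOL-Probability.Probability"
begin

text \<open>Vectors of R^d are represented as functions nat => real, of which only the
coordinates 0..d-1 are used; d x d matrices as nat => nat => real (entries i,j < d used).\<close>

definition etat :: "real \<Rightarrow> real" where
  "etat eta = max 1 eta"

definition ip :: "nat \<Rightarrow> (nat \<Rightarrow> real) \<Rightarrow> (nat \<Rightarrow> real) \<Rightarrow> real" where
  "ip d u v = (\<Sum>i<d. u i * v i)"

definition clip :: "real \<Rightarrow> real" where
  "clip z = min 1 (max (-1) z)"

definition Mmat :: "real \<Rightarrow> (nat \<Rightarrow> nat \<Rightarrow> real) \<Rightarrow> nat set \<Rightarrow> nat \<Rightarrow> nat \<Rightarrow> real" where
  "Mmat C x S = (\<lambda>i j. (if i = j then 1 / C^2 else 0) + (\<Sum>s\<in>S. x s i * x s j))"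

definition mv :: "nat \<Rightarrow> (nat \<Rightarrow> nat \<Rightarrow> real) \<Rightarrow> (nat \<Rightarrow> real) \<Rightarrow> nat \<Rightarrow> real" where
  "mv d A v = (\<lambda>i. \<Sum>j<d. A i j * v j)"

text \<open>A^(-1) b: the unique solution v in R^d of A v = b (A is positive definite here).\<close>
definition msolve :: "nat \<Rightarrow> (nat \<Rightarrow> nat \<Rightarrow> real) \<Rightarrow> (nat \<Rightarrow> real) \<Rightarrow> nat \<Rightarrow> real" where
  "msolve d A b = (THE v. (\<forall>i<d. mv d A v i = b i) \<and> (\<forall>i. d \<le> i \<longrightarrow> v i = 0))"

definition delta :: "nat \<Rightarrow> real \<Rightarrow> real \<Rightarrow> (nat \<Rightarrow> nat \<Rightarrow> real) \<Rightarrow> nat set \<Rightarrow> nat \<Rightarrow> real" where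
  "delta d C eta x S t = (etat eta)^2 * min 1 (ip d (x t) (msolve d (Mmat C x S) (x t)))"

text \<open>Set of rounds among 1..t queried by QuFUR(alpha); U t in [0,1] is the learner's
  uniform coin for round t, and q_t = 1 iff U t < min 1 (alpha * Delta_t).\<close>
fun qset :: "nat \<Rightarrow> real \<Rightarrow> real \<Rightarrow> real \<Rightarrow> (nat \<Rightarrow> nat \<Rightarrow> real) \<Rightarrow> (nat \<Rightarrow> real) \<Rightarrow> nat \<Rightarrow> nat set" where
  "qset d C eta alpha x U 0 = {}"
| "qset d C eta alpha x U (Suc t) =
     (let S = qset d C eta alpha x U t
      in if U (Suc t) < min 1 (alpha * delta d C eta x S (Suc t)) then insert (Suc t) S else S)"

definition yhat :: "nat \<Rightarrow> real \<Rightarrow> real \<Rightarrow> real \<Rightarrow> (nat \<Rightarrow> nat \<Rightarrow> real) \<Rightarrow> (nat \<Rightarrow> real) \<Rightarrow> (nat \<Rightarrow> real) \<Rightarrow> nat \<Rightarrow> real" where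
  "yhat d C eta alpha x U y t =
     (let S = qset d C eta alpha x U (t - 1);
          th = msolve d (Mmat C x S) (\<lambda>i. \<Sum>s\<in>S. x s i * y s)
      in clip (ip d th (x t)))"

definition query_complexity :: "nat \<Rightarrow> real \<Rightarrow> real \<Rightarrow> real \<Rightarrow> (nat \<Rightarrow> nat \<Rightarrow> real) \<Rightarrow> (nat \<Rightarrow> real) \<Rightarrow> nat \<Rightarrow> nat" where
  "query_complexity d C eta alpha x U T = card (qset d C eta alpha x U T)"

definition regret :: "nat \<Rightarrow> real \<Rightarrow> real \<Rightarrow> real \<Rightarrow> (nat \<Rightarrow> nat \<Rightarrow> real) \<Rightarrow> (nat \<Rightarrow> real) \<Rightarrow> (nat \<Rightarrow> real) \<Rightarrow> (nat \<Rightarrow> real) \<Rightarrow> nat \<Rightarrow> real" where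
  "regret d C eta alpha x U y theta T =
     (\<Sum>t=1..T. (yhat d C eta alpha x U y t - ip d theta (x t))^2)"

definition in_subspace_dim :: "nat \<Rightarrow> nat \<Rightarrow> (nat \<Rightarrow> real) set \<Rightarrow> bool" where
  "in_subspace_dim d k V =
     (\<exists>B :: nat \<Rightarrow> nat \<Rightarrow> real.
        (\<forall>c :: nat \<Rightarrow> real. (\<forall>i<d. (\<Sum>j<k. c j * B j i) = 0) \<longrightarrow> (\<forall>j<k. c j = 0)) \<and>
        (\<forall>v\<in>V. \<exists>c :: nat \<Rightarrow> real. \<forall>i<d. v i = (\<Sum>j<k. c j * B j i)))"

text \<open>Canonical sample space: omega = (noise sequence xi, learner coin sequence U).
  Noise: independent zero-mean sub-Gaussian with variance proxy eta^2; coins: i.i.d.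
  uniform on [0,1]; all mutually independent (rounds 1..T).\<close>
type_synonym omega = "(nat \<Rightarrow> real) \<times> (nat \<Rightarrow> real)"

definition noise_model :: "omega measure \<Rightarrow> real \<Rightarrow> nat \<Rightarrow> bool" where
  "noise_model M eta T =
     (prob_space M \<and>
      prob_space.indep_vars M (\<lambda>_. borel)
        (\<lambda>i. case i of Inl t \<Rightarrow> (\<lambda>\<omega>. fst \<omega> t) | Inr t \<Rightarrow> (\<lambda>\<omega>. snd \<omega> t))
        (Inl ` {1..T} \<union> Inr ` {1..T}) \<and>
      (\<forall>t\<in>{1..T}.
         (\<lambda>\<omega>. fst \<omega> t) \<in> borel_measurable M \<and>
         integrable M (\<lambda>\<omega>. fst \<omega> t) \<and>
         prob_space.expectation M (\<lambda>\<omega>. fst \<omega> t) = 0 \<and>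
         (\<forall>l::real. integrable M (\<lambda>\<omega>. exp (l * fst \<omega> t)) \<and>
            prob_space.expectation M (\<lambda>\<omega>. exp (l * fst \<omega> t)) \<le> exp (l^2 * eta^2 / 2)) \<and>
         (\<lambda>\<omega>. snd \<omega> t) \<in> borel_measurable M \<and>
         distr M borel (\<lambda>\<omega>. snd \<omega> t) = uniform_measure lborel {0..1}))"

end

theory Submission
  imports Defs
begin

text \<open>
The queried set depends only on the coins and the fixed design, never on the noise. Given the
queried set, the estimation error in direction \<open>x\<^sub>t\<close> is therefore a bias of size at most
\<open>\<parallel>x\<^sub>t\<parallel>\<close> in the norm of \<open>M\<^sub>t\<^sup>-\<^sup>1\<close> plus a fixed linear combination of the noise variables whose
variance proxy is at most \<open>\<eta>\<^sup>2 \<parallel>x\<^sub>t\<parallel>\<^sup>2\<close>; hence the squared error is at most \<open>\<Delta>\<^sub>t\<close> up to logarithms,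
without a factor \<open>d\<close>. With \<open>p\<^sub>t = min 1 (\<alpha> \<Delta>\<^sub>t)\<close>, the sum of \<open>p\<^sub>t \<Delta>\<^sub>t\<close> over \<open>I\<^sub>u\<close> is comparable to
the sum of \<open>q\<^sub>t \<Delta>\<^sub>t\<close>, which the elliptic potential inside the \<open>d\<^sub>u\<close>-dimensional subspace bounds by
\<open>\<eta>\<^sup>2 d\<^sub>u\<close> up to logarithms. Since \<open>p\<^sub>t\<^sup>2 \<le> \<alpha> p\<^sub>t \<Delta>\<^sub>t\<close> and \<open>\<Delta>\<^sub>t \<le> p\<^sub>t \<Delta>\<^sub>t + \<surd>(p\<^sub>t \<Delta>\<^sub>t / \<alpha>)\<close>, Cauchy-Schwarz
gives both claims. All random events are controlled by one Markov bound for a sum of at most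
\<open>4 T\<close> exponentials of mean at most one.
\<close>

section \<open>Rank-one updates of regularised Gram matrices\<close>

definition rank1 :: "(nat \<Rightarrow> nat \<Rightarrow> real) \<Rightarrow> (nat \<Rightarrow> real) \<Rightarrow> nat \<Rightarrow> nat \<Rightarrow> real" where
  "rank1 N a = (\<lambda>i j. N i j + a i * a j)"

text \<open>Describes the positive definite matrices needed here as \<open>c\<close> times the
  identity plus finitely many rank-one terms. Rule induction then proves symmetry, coercivity and
  solvability one rank-one term at a time.\<close>

inductive ridge :: "real \<Rightarrow> (nat \<Rightarrow> nat \<Rightarrow> real) \<Rightarrow> bool" for c where
  ridge_base: "ridge c (\<lambda>i j. if i = j then c else 0)"
| ridge_rank1: "ridge c N \<Longrightarrow> ridge c (rank1 N a)"

text \<open>The bilinear form a^T N^-1 b. For equal arguments it is the squared norm in the metric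
  of the inverse matrix, which is the quantity inside \<open>delta\<close>.\<close>

definition inv_ip :: "nat \<Rightarrow> (nat \<Rightarrow> nat \<Rightarrow> real) \<Rightarrow> (nat \<Rightarrow> real) \<Rightarrow> (nat \<Rightarrow> real) \<Rightarrow> real" where
  "inv_ip d N a b = ip d a (msolve d N b)"

lemma ip_commute: "ip d u v = ip d v u"
  by (simp add: ip_def mult.commute)

lemma ip_cong: "(\<And>i. i < d \<Longrightarrow> u i = u' i) \<Longrightarrow> (\<And>i. i < d \<Longrightarrow> v i = v' i) \<Longrightarrow> ip d u v = ip d u' v'"
  by (simp add: ip_def)

lemma ip_diff_right: "ip d w (\<lambda>i. u i - v i) = ip d w u - ip d w v"
  by (simp add: ip_def right_diff_distrib sum_subtractf)

lemma ip_scale_right: "ip d w (\<lambda>i. k * u i) = k * ip d w u"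
  by (simp add: ip_def sum_distrib_left mult.left_commute)

lemma ip_sum_left: "ip d (\<lambda>i. \<Sum>s\<in>S. f s i) w = (\<Sum>s\<in>S. ip d (f s) w)"
  by (simp add: ip_def sum_distrib_right) (rule sum.swap)

lemma ip_scale_left: "ip d (\<lambda>i. k * u i) w = k * ip d u w"
  by (simp add: ip_def sum_distrib_left mult.assoc)

lemma ip_self_nonneg: "0 \<le> ip d v v"
  by (simp add: ip_def sum_nonneg)

lemma ip_self_eq_0: "ip d v v = 0 \<Longrightarrow> i < d \<Longrightarrow> v i = 0"
  by (simp add: ip_def sum_nonneg_eq_0_iff)

lemma ip_Cauchy_Schwarz: "(ip d u v)\<^sup>2 \<le> ip d u u * ip d v v"
  using Cauchy_Schwarz_ineq_sum[of u v "{..<d}"] by (simp add: ip_def power2_eq_square)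

lemma mv_rank1: "mv d (rank1 N a) v i = mv d N v i + ip d a v * a i"
  by (simp add: mv_def rank1_def ip_def algebra_simps sum.distrib sum_distrib_left)

lemma mv_diff_scale: "mv d N (\<lambda>i. v i - k * w i) i = mv d N v i - k * mv d N w i"
  by (simp add: mv_def right_diff_distrib sum_subtractf sum_distrib_left mult.left_commute)

lemma mv_diag: "i < d \<Longrightarrow> mv d (\<lambda>i j. if i = j then c else 0) v i = c * v i"
  by (simp add: mv_def if_distrib[of "\<lambda>x. x * _"] cong: if_cong)

lemma ip_mv_rank1: "ip d v (mv d (rank1 N a) w) = ip d v (mv d N w) + ip d a v * ip d a w"
proof -
  have "ip d v (mv d (rank1 N a) w) = ip d v (mv d N w) + ip d v (\<lambda>i. ip d a w * a i)"
    by (simp add: ip_def mv_rank1 distrib_left sum.distrib)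
  then show ?thesis
    by (simp add: ip_scale_right ip_commute[of d v a])
qed

section \<open>Symmetry, coercivity and solvability of ridge matrices\<close>

lemma ridge_symmetric:
  assumes "ridge c N"
  shows "ip d u (mv d N v) = ip d v (mv d N u)"
  using assms
proof induction
  case ridge_base
  have "ip d u (mv d (\<lambda>i j. if i = j then c else 0) v) = c * ip d u v" for u v
    unfolding ip_scale_right[symmetric] by (rule ip_cong) (simp_all add: mv_diag)
  then show ?case by (simp add: ip_commute)
next
  case (ridge_rank1 N a)
  then show ?case by (simp add: ip_mv_rank1)
qed

lemma ridge_coercive:
  assumes "ridge c N"
  shows "c * ip d v v \<le> ip d v (mv d N v)"
  using assms
proof induction
  case ridge_base
  have "ip d v (mv d (\<lambda>i j. if i = j then c else 0) v) = c * ip d v v"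
    unfolding ip_scale_right[symmetric] by (rule ip_cong) (simp_all add: mv_diag)
  then show ?case by simp
next
  case (ridge_rank1 N a)
  then show ?case by (simp add: ip_mv_rank1 add_increasing2)
qed

text \<open>The induction keeps the right-hand side arbitrary because the update by \<open>a\<close>
  needs the old system solved both for \<open>b\<close> and for \<open>a\<close>; the
  Sherman-Morrison combination of the two solutions solves the new system.\<close>

lemma ridge_solvable:
  assumes "ridge c N" "c > 0"
  shows "\<exists>v. (\<forall>i<d. mv d N v i = b i) \<and> (\<forall>i. d \<le> i \<longrightarrow> v i = 0)"
  using assms(1)
proof (induction arbitrary: b)
  case ridge_base
  show ?case
    using \<open>c > 0\<close> by (intro exI[of _ "\<lambda>i. if i < d then b i / c else 0"]) (simp add: mv_diag)
next
  case (ridge_rank1 N a)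
  obtain v where v: "\<And>i. i < d \<Longrightarrow> mv d N v i = b i" "\<And>i. d \<le> i \<Longrightarrow> v i = 0"
    using ridge_rank1.IH[of b] by blast
  obtain w where w: "\<And>i. i < d \<Longrightarrow> mv d N w i = a i" "\<And>i. d \<le> i \<Longrightarrow> w i = 0"
    using ridge_rank1.IH[of a] by blast
  have "ip d a w = ip d w (mv d N w)"
    by (subst ip_commute) (rule ip_cong, simp_all add: w)
  then have pos: "0 \<le> ip d a w"
    using ridge_coercive[OF ridge_rank1.hyps, of d w] ip_self_nonneg[of d w] \<open>c > 0\<close>
    by (smt (verit) mult_nonneg_nonneg)
  \<comment> \<open>The Sherman-Morrison coefficient; \<open>pos\<close> makes its denominator
    nonzero.\<close>
  define k where "k = ip d a v / (1 + ip d a w)"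
  have k: "ip d a v = k * (1 + ip d a w)"
    using pos by (simp add: k_def)
  have "mv d (rank1 N a) (\<lambda>i. v i - k * w i) i = b i" if "i < d" for i
    using that k by (simp add: mv_rank1 mv_diff_scale ip_diff_right ip_scale_right v w algebra_simps)
  then show ?case
    using v w by (intro exI[of _ "\<lambda>i. v i - k * w i"]) simp
qed

lemma ridge_unique:
  assumes "ridge c N" "c > 0"
    and "\<forall>i<d. mv d N v i = b i" "\<forall>i. d \<le> i \<longrightarrow> v i = 0"
    and "\<forall>i<d. mv d N w i = b i" "\<forall>i. d \<le> i \<longrightarrow> w i = 0"
  shows "v = w"
proof
  fix i
  \<comment> \<open>Coercivity forces the difference of two solutions to vanish. The factor 1 brings
    it into the shape of \<open>mv_diff_scale\<close>.\<close>
  define u where "u = (\<lambda>i. v i - 1 * w i)"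
  have "ip d u (mv d N u) = ip d u (\<lambda>_. 0)"
    unfolding u_def by (rule ip_cong) (use assms in \<open>simp_all add: mv_diff_scale[of _ _ _ 1, simplified]\<close>)
  then have "c * ip d u u \<le> 0"
    using ridge_coercive[OF assms(1), of d u] by (simp add: ip_def)
  then have "ip d u u = 0"
    using ip_self_nonneg[of d u] \<open>c > 0\<close> by (simp add: mult_le_0_iff)
  then show "v i = w i"
    using ip_self_eq_0[of d u i] assms by (cases "i < d") (auto simp: u_def)
qed

lemma msolve_eqI:
  assumes "ridge c N" "c > 0" "\<And>i. i < d \<Longrightarrow> mv d N v i = b i" "\<And>i. d \<le> i \<Longrightarrow> v i = 0"
  shows "msolve d N b = v"
  unfolding msolve_def
  by (rule the_equality) (use assms in \<open>auto intro: ridge_unique[OF assms(1,2)]\<close>)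

lemma msolve_solves:
  assumes "ridge c N" "c > 0"
  shows "i < d \<Longrightarrow> mv d N (msolve d N b) i = b i" and "d \<le> i \<Longrightarrow> msolve d N b i = 0"
proof -
  obtain v where "\<And>i. i < d \<Longrightarrow> mv d N v i = b i" "\<And>i. d \<le> i \<Longrightarrow> v i = 0"
    using ridge_solvable[OF assms] by blast
  with msolve_eqI[OF assms this]
  show "i < d \<Longrightarrow> mv d N (msolve d N b) i = b i" and "d \<le> i \<Longrightarrow> msolve d N b i = 0"
    by auto
qed

section \<open>The inverse bilinear form and its rank-one updates\<close>

lemma ip_mv_msolve:
  assumes "ridge c N" "c > 0"
  shows "ip d u (mv d N (msolve d N b)) = ip d u b"
  by (rule ip_cong) (use msolve_solves(1)[OF assms] in auto)

lemma inv_ip_symmetric: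
  assumes "ridge c N" "c > 0"
  shows "inv_ip d N a b = inv_ip d N b a"
  using ridge_symmetric[OF assms(1), of d "msolve d N a" "msolve d N b"]
  by (simp add: inv_ip_def ip_mv_msolve[OF assms] ip_commute[of d "msolve d N _"])

lemma inv_ip_self:
  assumes "ridge c N" "c > 0"
  shows "inv_ip d N a a = ip d (msolve d N a) (mv d N (msolve d N a))"
  by (simp add: inv_ip_def ip_mv_msolve[OF assms] ip_commute)

lemma inv_ip_nonneg:
  assumes "ridge c N" "c > 0"
  shows "0 \<le> inv_ip d N a a"
  using ridge_coercive[OF assms(1), of d "msolve d N a"] ip_self_nonneg[of d "msolve d N a"] \<open>c > 0\<close>
  unfolding inv_ip_self[OF assms] by (smt (verit) mult_nonneg_nonneg)

text \<open>Variational upper bound: testing the hypothesis at v = N^-1 a turns both the inner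
  product and the quadratic form into the value q to be bounded, so q^2 \<le> \<kappa> q. It
  replaces comparison of inverse matrices.\<close>

lemma inv_ip_le:
  assumes "ridge c N" "c > 0" "\<kappa> \<ge> 0"
    and "\<And>v. (ip d a v)\<^sup>2 \<le> \<kappa> * ip d v (mv d N v)"
  shows "inv_ip d N a a \<le> \<kappa>"
proof -
  have "(inv_ip d N a a)\<^sup>2 \<le> \<kappa> * inv_ip d N a a"
    using assms(4)[of "msolve d N a"] unfolding inv_ip_self[OF assms(1,2), symmetric]
    by (simp add: inv_ip_def)
  then show ?thesis
    using inv_ip_nonneg[OF assms(1,2), of d a] assms(3)
    by (cases "inv_ip d N a a = 0") (auto simp: power2_eq_square)
qed

lemma inv_ip_le_norm:
  assumes "ridge c N" "c > 0"
  shows "inv_ip d N a a \<le> ip d a a / c"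
proof (rule inv_ip_le[OF assms])
  show "0 \<le> ip d a a / c" using ip_self_nonneg assms(2) by simp
  fix v
  have "(ip d a v)\<^sup>2 \<le> ip d a a * ip d v v" by (rule ip_Cauchy_Schwarz)
  also have "ip d v v \<le> ip d v (mv d N v) / c"
    using ridge_coercive[OF assms(1), of d v] assms(2) by (simp add: field_simps)
  finally show "(ip d a v)\<^sup>2 \<le> ip d a a / c * ip d v (mv d N v)"
    using ip_self_nonneg[of d a] by (simp add: mult_left_mono)
qed

text \<open>The Sherman-Morrison formula, with its coefficients written as values of
  \<open>inv_ip\<close>.\<close>

lemma msolve_rank1:
  assumes "ridge c N" "c > 0"
  shows "msolve d (rank1 N a) b =
    (\<lambda>i. msolve d N b i - inv_ip d N a b / (1 + inv_ip d N a a) * msolve d N a i)"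
proof -
  define k where "k = inv_ip d N a b / (1 + inv_ip d N a a)"
  have k: "inv_ip d N a b = k * (1 + inv_ip d N a a)"
    using inv_ip_nonneg[OF assms, of d a] by (simp add: k_def)
  have "msolve d (rank1 N a) b = (\<lambda>i. msolve d N b i - k * msolve d N a i)"
  proof (rule msolve_eqI[OF ridge_rank1[OF assms(1)] assms(2)])
    fix i assume "i < d"
    then show "mv d (rank1 N a) (\<lambda>i. msolve d N b i - k * msolve d N a i) i = b i"
      using k by (simp add: mv_rank1 mv_diff_scale ip_diff_right ip_scale_right
          msolve_solves(1)[OF assms] inv_ip_def algebra_simps)
  qed (simp add: msolve_solves(2)[OF assms])
  then show ?thesis by (simp add: k_def)
qed

lemma inv_ip_rank1:
  assumes "ridge c N" "c > 0"
  shows "inv_ip d (rank1 N a) b b = inv_ip d N b b - (inv_ip d N a b)\<^sup>2 / (1 + inv_ip d N a a)"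
  unfolding inv_ip_def[of d "rank1 N a"] msolve_rank1[OF assms] ip_diff_right ip_scale_right
  unfolding inv_ip_def[symmetric]
  by (simp add: power2_eq_square inv_ip_symmetric[OF assms, of d b a])

lemma inv_ip_rank1_le:
  assumes "ridge c N" "c > 0"
  shows "inv_ip d (rank1 N a) b b \<le> inv_ip d N b b"
  using inv_ip_nonneg[OF assms, of d a] by (simp add: inv_ip_rank1[OF assms])

text \<open>Both sides are the ratio of the determinants of \<open>N + a a\<^sup>T + b b\<^sup>T\<close> and \<open>N\<close>; this
  exchange rule replaces determinants in the elliptic potential argument.\<close>
lemma inv_ip_rank1_exchange:
  assumes "ridge c N" "c > 0"
  shows "(1 + inv_ip d N a a) * (1 + inv_ip d (rank1 N a) b b) =
         (1 + inv_ip d N b b) * (1 + inv_ip d (rank1 N b) a a)"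
proof -
  \<comment> \<open>Both sides become (1 + A)(1 + B) - G, where A and B are the squared norms of
    \<open>a\<close> and \<open>b\<close> and G is the square of their inner product; this is
    symmetric in \<open>a\<close> and \<open>b\<close>.\<close>
  have *: "(1 + A) * (1 + (B - G / (1 + A))) = (1 + A) * (1 + B) - G" if "A \<ge> 0" for A B G :: real
    using that by (simp add: field_simps)
  show ?thesis
    unfolding inv_ip_rank1[OF assms] *[OF inv_ip_nonneg[OF assms]]
    by (simp add: inv_ip_symmetric[OF assms, of d a b] algebra_simps)
qed

section \<open>Elliptic potential in a subspace\<close>

text \<open>The starting matrix is a parameter because the potential argument replaces the
  regulariser by one enlarged with further rank-one terms.\<close>

definition gmat :: "(nat \<Rightarrow> nat \<Rightarrow> real) \<Rightarrow> (nat \<Rightarrow> nat \<Rightarrow> real) \<Rightarrow> nat set \<Rightarrow> nat \<Rightarrow> nat \<Rightarrow> real" where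
  "gmat N x S = (\<lambda>i j. N i j + (\<Sum>s\<in>S. x s i * x s j))"

lemma Mmat_eq_gmat: "Mmat C x S = gmat (\<lambda>i j. if i = j then 1 / C^2 else 0) x S"
  by (simp add: Mmat_def gmat_def)

lemma gmat_empty [simp]: "gmat N x {} = N"
  by (simp add: gmat_def)

lemma gmat_insert: "finite S \<Longrightarrow> t \<notin> S \<Longrightarrow> gmat N x (insert t S) = rank1 (gmat N x S) (x t)"
  by (simp add: gmat_def rank1_def fun_eq_iff)

lemma gmat_rank1: "gmat (rank1 N a) x S = rank1 (gmat N x S) a"
  by (simp add: gmat_def rank1_def fun_eq_iff)

lemma ridge_gmat:
  assumes "ridge c N" "finite S"
  shows "ridge c (gmat N x S)"
  using assms(2) by induction (simp_all add: assms(1) gmat_insert ridge_rank1)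

lemma ridge_Mmat: "finite S \<Longrightarrow> ridge (1 / C^2) (Mmat C x S)"
  unfolding Mmat_eq_gmat by (intro ridge_gmat ridge_base)

lemma ip_mv_gmat:
  assumes "finite S"
  shows "ip d v (mv d (gmat N x S) w) = ip d v (mv d N w) + (\<Sum>s\<in>S. ip d (x s) v * ip d (x s) w)"
  using assms by induction (simp_all add: gmat_insert ip_mv_rank1)

lemma ip_mv_Mmat:
  assumes "finite S"
  shows "ip d v (mv d (Mmat C x S) w) = ip d v w / C^2 + (\<Sum>s\<in>S. ip d (x s) v * ip d (x s) w)"
proof -
  have "ip d v (mv d (\<lambda>i j. if i = j then 1 / C^2 else 0) w) = 1 / C^2 * ip d v w"
    unfolding ip_scale_right[symmetric] by (rule ip_cong) (simp_all add: mv_diag)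
  then show ?thesis by (simp add: Mmat_eq_gmat ip_mv_gmat[OF assms])
qed

lemma inv_ip_gmat_antimono:
  assumes "ridge c N" "c > 0" "finite S'" "S \<subseteq> S'"
  shows "inv_ip d (gmat N x S') b b \<le> inv_ip d (gmat N x S) b b"
proof -
  have "finite S" using assms finite_subset by blast
  \<comment> \<open>The extra rounds are added one at a time. A round already in \<open>S\<close>
    changes nothing, since the design is indexed by a set.\<close>
  have "inv_ip d (gmat N x (S \<union> A)) b b \<le> inv_ip d (gmat N x S) b b" if "finite A" for A
    using that
  proof induction
    case (insert t A)
    show ?case
    proof (cases "t \<in> S")
      case True
      then show ?thesis using insert.IH by (simp add: insert_absorb)
    next
      case False
      then have "gmat N x (S \<union> insert t A) = rank1 (gmat N x (S \<union> A)) (x t)"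
        using insert.hyps \<open>finite S\<close> by (simp add: gmat_insert)
      then show ?thesis
        using inv_ip_rank1_le[OF ridge_gmat[OF assms(1), of "S \<union> A" x] assms(2), of d "x t" b]
          insert \<open>finite S\<close> by simp
    qed
  qed simp
  from this[of S'] show ?thesis
    using assms by (simp add: Un_absorb1)
qed

section \<open>Determinant ratios of growing designs\<close>

lemma Int_atLeastAtMost_Suc:
  "S \<inter> {1..Suc n} = (if Suc n \<in> S then insert (Suc n) (S \<inter> {1..n}) else S \<inter> {1..n})"
  by (auto simp: le_Suc_eq)

text \<open>By the matrix determinant lemma this product telescopes to the determinant of the design
  matrix after round \<open>n\<close> divided by the determinant of \<open>N\<close>.\<close>

definition potential :: "nat \<Rightarrow> (nat \<Rightarrow> nat \<Rightarrow> real) \<Rightarrow> nat set \<Rightarrow> (nat \<Rightarrow> nat \<Rightarrow> real) \<Rightarrow> nat \<Rightarrow> real" where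
  "potential d x S N n =
     (\<Prod>s\<in>S \<inter> {1..n}. 1 + inv_ip d (gmat N x (S \<inter> {1..<s})) (x s) (x s))"

lemma potential_Suc:
  "potential d x S N (Suc n) = potential d x S N n *
     (if Suc n \<in> S then 1 + inv_ip d (gmat N x (S \<inter> {1..n})) (x (Suc n)) (x (Suc n)) else 1)"
proof -
  have "{1..<Suc n} = {1..n}" by auto
  then show ?thesis
    unfolding potential_def Int_atLeastAtMost_Suc by (simp add: mult.commute)
qed

lemma potential_nonneg:
  assumes "ridge c N" "c > 0"
  shows "0 \<le> potential d x S N n"
  unfolding potential_def
  using inv_ip_nonneg[OF ridge_gmat[OF assms(1)] assms(2)]
  by (intro prod_nonneg) (simp add: add_nonneg_nonneg)

text \<open>Both sides are the determinant ratio of the design enlarged by \<open>a\<close>: on the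
  left \<open>a\<close> is added last, on the right first. Each induction step moves
  \<open>a\<close> past one vector by the exchange rule.\<close>

lemma potential_exchange:
  assumes "ridge c N" "c > 0"
  shows "potential d x S N n * (1 + inv_ip d (gmat N x (S \<inter> {1..n})) a a) =
         (1 + inv_ip d N a a) * potential d x S (rank1 N a) n"
proof (induction n)
  case 0
  then show ?case by (simp add: potential_def)
next
  case (Suc n)
  show ?case
  proof (cases "Suc n \<in> S")
    case True
    let ?N = "gmat N x (S \<inter> {1..n})" and ?b = "x (Suc n)"
    have "gmat N x (S \<inter> {1..Suc n}) = rank1 ?N ?b"
      using True by (simp only: Int_atLeastAtMost_Suc if_True) (subst gmat_insert, auto)
    then show ?thesis
      using True Suc.IH inv_ip_rank1_exchange[OF ridge_gmat[OF assms(1), of "S \<inter> {1..n}" x] assms(2), of d ?b a]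
      by (simp add: potential_Suc gmat_rank1 mult.assoc)
  next
    case False
    then show ?thesis
      using Suc.IH by (simp add: potential_Suc Int_atLeastAtMost_Suc[unfolded One_nat_def])
  qed
qed

text \<open>Appending \<open>a\<close> at the end can only increase the potential, while its factor
  at the beginning is controlled by the regulariser alone.\<close>

lemma potential_le_rank1:
  assumes "ridge c N" "c > 0"
  shows "potential d x S N n \<le> (1 + ip d a a / c) * potential d x S (rank1 N a) n"
proof -
  have "potential d x S N n \<le> potential d x S N n * (1 + inv_ip d (gmat N x (S \<inter> {1..n})) a a)"
    using potential_nonneg[OF assms, of d x S n]
      inv_ip_nonneg[OF ridge_gmat[OF assms(1), of "S \<inter> {1..n}" x] assms(2), of d a]
    by (intro mult_le_cancel_left1[THEN iffD2]) auto
  also have "\<dots> \<le> (1 + ip d a a / c) * potential d x S (rank1 N a) n"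
    unfolding potential_exchange[OF assms]
    using inv_ip_le_norm[OF assms, of d a] potential_nonneg[OF ridge_rank1[OF assms(1)] assms(2)]
    by (simp add: mult_right_mono)
  finally show ?thesis .
qed

lemma potential_le_gmat:
  assumes "ridge c N" "c > 0" "\<And>j. j < k \<Longrightarrow> ip d (e j) (e j) / c \<le> \<beta>" "\<beta> \<ge> 0"
  shows "potential d x S N n \<le> (1 + \<beta>) ^ k * potential d x S (gmat N e {..<k}) n"
  using assms(3)
proof (induction k)
  case (Suc k)
  let ?P = "potential d x S (gmat N e {..<Suc k}) n"
  have g: "gmat N e {..<Suc k} = rank1 (gmat N e {..<k}) (e k)"
    by (simp add: lessThan_Suc gmat_insert)
  have r: "ridge c (gmat N e {..<k})" using assms(1) by (simp add: ridge_gmat)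
  have P: "0 \<le> ?P" unfolding g by (rule potential_nonneg[OF ridge_rank1[OF r] assms(2)])
  have "potential d x S (gmat N e {..<k}) n \<le> (1 + ip d (e k) (e k) / c) * ?P"
    unfolding g by (rule potential_le_rank1[OF r assms(2)])
  also have "\<dots> \<le> (1 + \<beta>) * ?P"
    using Suc.prems[of k] P by (intro mult_right_mono) auto
  finally have "(1 + \<beta>) ^ k * potential d x S (gmat N e {..<k}) n \<le> (1 + \<beta>) ^ k * ((1 + \<beta>) * ?P)"
    using assms(4) by (intro mult_left_mono) auto
  then show ?case using Suc by (simp add: mult.assoc mult.left_commute)
qed simp

text \<open>By Cauchy-Schwarz, the square of the inner product of \<open>a\<close> with any
  \<open>v\<close> is at most the sum of the \<open>(w j)\<^sup>2\<close> times the part of the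
  quadratic form contributed by the vectors \<open>e j\<close>.\<close>

lemma inv_ip_gmat_span_le:
  assumes "ridge c N" "c > 0" "finite S"
    and "\<And>i. i < d \<Longrightarrow> a i = (\<Sum>j<k. w j * e j i)"
  shows "inv_ip d (gmat (gmat N e {..<k}) x S) a a \<le> (\<Sum>j<k. (w j)\<^sup>2)"
proof (rule inv_ip_le)
  show "ridge c (gmat (gmat N e {..<k}) x S)" using assms by (intro ridge_gmat) auto
  fix v
  have "ip d a v = ip d (\<lambda>i. \<Sum>j<k. w j * e j i) v"
    by (rule ip_cong) (use assms in auto)
  also have "\<dots> = (\<Sum>j<k. w j * ip d (e j) v)"
    by (simp add: ip_sum_left ip_scale_left)
  finally have "(ip d a v)\<^sup>2 \<le> (\<Sum>j<k. (w j)\<^sup>2) * (\<Sum>j<k. (ip d (e j) v)\<^sup>2)"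
    using Cauchy_Schwarz_ineq_sum[of w "\<lambda>j. ip d (e j) v" "{..<k}"] by simp
  also have "(\<Sum>j<k. (ip d (e j) v)\<^sup>2) \<le> ip d v (mv d (gmat (gmat N e {..<k}) x S) v)"
  proof -
    have "0 \<le> ip d v (mv d N v)"
      using ridge_coercive[OF assms(1), of d v] ip_self_nonneg[of d v] assms(2)
      by (smt (verit) mult_nonneg_nonneg)
    moreover have "0 \<le> (\<Sum>s\<in>S. ip d (x s) v * ip d (x s) v)" by (simp add: sum_nonneg)
    ultimately show ?thesis
      using assms(3) by (simp add: ip_mv_gmat power2_eq_square)
  qed
  finally show "(ip d a v)\<^sup>2 \<le> (\<Sum>j<k. (w j)\<^sup>2) * ip d v (mv d (gmat (gmat N e {..<k}) x S) v)"
    by (simp add: mult_left_mono sum_nonneg)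
qed (use assms in \<open>auto simp: sum_nonneg\<close>)

text \<open>Linearly dependent inputs produce zero vectors instead of a shorter basis.\<close>
lemma Gram_Schmidt:
  fixes B :: "nat \<Rightarrow> nat \<Rightarrow> real"
  shows "\<exists>e. (\<forall>j<k. ip d (e j) (e j) \<in> {0, 1}) \<and> (\<forall>j<k. \<forall>l<k. j \<noteq> l \<longrightarrow> ip d (e j) (e l) = 0) \<and>
    (\<forall>j<k. \<exists>w. \<forall>i<d. B j i = (\<Sum>l<k. w l * e l i))"
proof (induction k)
  case (Suc k)
  then obtain e where norm: "\<And>j. j < k \<Longrightarrow> ip d (e j) (e j) \<in> {0, 1}"
    and orth: "\<And>j l. j < k \<Longrightarrow> l < k \<Longrightarrow> j \<noteq> l \<Longrightarrow> ip d (e j) (e l) = 0"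
    and span: "\<And>j. j < k \<Longrightarrow> \<exists>w. \<forall>i<d. B j i = (\<Sum>l<k. w l * e l i)"
    by blast
  define r where "r = (\<lambda>i. B k i - (\<Sum>j<k. ip d (B k) (e j) * e j i))"
  define s where "s = sqrt (ip d r r)"
  \<comment> \<open>If the residual \<open>r\<close> vanishes then \<open>s = 0\<close>, and
    division by zero makes the new vector zero, as intended for dependent inputs.\<close>
  define f where "f = e(k := \<lambda>i. 1 / s * r i)"
  have "ip d (e l) r = 0" if "l < k" for l
  proof -
    have "ip d (e l) (\<lambda>i. \<Sum>j<k. ip d (B k) (e j) * e j i)
        = (\<Sum>j<k. ip d (B k) (e j) * ip d (e j) (e l))"
      by (subst ip_commute) (simp add: ip_sum_left ip_scale_left)
    also have "\<dots> = (\<Sum>j<k. if j = l then ip d (B k) (e l) * ip d (e l) (e l) else 0)"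
      using orth that by (intro sum.cong) auto
    also have "\<dots> = ip d (B k) (e l) * ip d (e l) (e l)"
      using that by simp
    also have "\<dots> = ip d (B k) (e l)"
    \<comment> \<open>A zero vector \<open>e l\<close> has inner product zero with
      \<open>B k\<close>, so the identity also holds there.\<close>
    proof (cases "ip d (e l) (e l) = 0")
      case True
      then have "ip d (B k) (e l) = 0"
        using ip_Cauchy_Schwarz[of d "B k" "e l"] by simp
      then show ?thesis by simp
    qed (use norm[OF that] in auto)
    finally show ?thesis by (simp add: r_def ip_diff_right ip_commute)
  qed
  then have orth_r: "ip d (e l) (\<lambda>i. 1 / s * r i) = 0" "ip d (\<lambda>i. 1 / s * r i) (e l) = 0" if "l < k" for l
    using that ip_scale_right[of d "e l" "1 / s" r] ip_commute[of d "e l" "\<lambda>i. 1 / s * r i"] by simp_all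
  have ss: "s * s = ip d r r" using ip_self_nonneg[of d r] by (simp add: s_def)
  have "ip d (f k) (f k) = 1 / s * (1 / s * (s * s))"
    unfolding ss f_def by (simp only: fun_upd_same ip_scale_left ip_scale_right)
  then have norm_f: "ip d (f j) (f j) \<in> {0, 1}" if "j < Suc k" for j
    using norm[of j] that by (cases "j = k"; cases "s = 0") (auto simp: f_def)
  have orth_f: "ip d (f j) (f l) = 0" if "j < Suc k" "l < Suc k" "j \<noteq> l" for j l
    using orth[of j l] orth_r that by (auto simp: f_def less_Suc_eq simp del: times_divide_eq_left)
  have span_f: "\<exists>w. \<forall>i<d. B j i = (\<Sum>l<Suc k. w l * f l i)" if j: "j < Suc k" for j
  proof (cases "j = k")
    case True
    have "s * f k i = r i" if "i < d" for i
      using ss ip_self_eq_0[of d r i] that by (cases "s = 0") (auto simp: f_def)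
    then show ?thesis
      using True by (intro exI[of _ "\<lambda>l. if l = k then s else ip d (B k) (e l)"]) (auto simp: f_def r_def)
  next
    case False
    then obtain w where "\<forall>i<d. B j i = (\<Sum>l<k. w l * e l i)"
      using span[of j] j by auto
    then show ?thesis
      by (intro exI[of _ "\<lambda>l. if l = k then 0 else w l"]) (auto simp: f_def)
  qed
  show ?case using norm_f orth_f span_f by blast
qed simp

text \<open>Parseval's identity in the span of the Gram-Schmidt vectors: a short vector of the
  subspace has coordinates with a small sum of squares, as required by
  \<open>inv_ip_gmat_span_le\<close>.\<close>

lemma orthonormal_coordinates:
  assumes "in_subspace_dim d k V"
  obtains e where "\<And>j. j < k \<Longrightarrow> ip d (e j) (e j) \<le> 1"
    and "\<And>a. a \<in> V \<Longrightarrow> \<exists>w. (\<forall>i<d. a i = (\<Sum>j<k. w j * e j i)) \<and> (\<Sum>j<k. (w j)\<^sup>2) \<le> ip d a a"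
proof -
  obtain B where B: "\<And>v. v \<in> V \<Longrightarrow> \<exists>c. \<forall>i<d. v i = (\<Sum>j<k. c j * B j i)"
    using assms unfolding in_subspace_dim_def by blast
  obtain e where norm: "\<And>j. j < k \<Longrightarrow> ip d (e j) (e j) \<in> {0, 1}"
    and orth: "\<And>j l. j < k \<Longrightarrow> l < k \<Longrightarrow> j \<noteq> l \<Longrightarrow> ip d (e j) (e l) = 0"
    and span: "\<And>j. j < k \<Longrightarrow> \<exists>w. \<forall>i<d. B j i = (\<Sum>l<k. w l * e l i)"
    using Gram_Schmidt[of k d B] by blast
  show ?thesis
  proof (rule that)
    show "ip d (e j) (e j) \<le> 1" if "j < k" for j using norm[OF that] by auto
    fix a assume "a \<in> V"
    then obtain c where c: "\<And>i. i < d \<Longrightarrow> a i = (\<Sum>j<k. c j * B j i)" using B by blast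
    obtain W where W: "\<And>j i. j < k \<Longrightarrow> i < d \<Longrightarrow> B j i = (\<Sum>l<k. W j l * e l i)"
      using span by metis
    \<comment> \<open>The last factor is 0 or 1. It discards the coefficients at zero vectors, which
      would otherwise count in the sum of squares without contributing to \<open>a\<close>.\<close>
    define w where "w l = (\<Sum>j<k. c j * W j l) * ip d (e l) (e l)" for l
    have a: "a i = (\<Sum>l<k. w l * e l i)" if "i < d" for i
    proof -
      have "a i = (\<Sum>j<k. \<Sum>l<k. c j * W j l * e l i)"
        using c[OF that] W that by (simp add: sum_distrib_left mult.assoc)
      also have "\<dots> = (\<Sum>l<k. (\<Sum>j<k. c j * W j l) * e l i)"
        by (subst sum.swap) (simp add: sum_distrib_right)
      also have "\<dots> = (\<Sum>l<k. w l * e l i)"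
      proof (intro sum.cong refl)
        fix l assume "l \<in> {..<k}"
        then have "ip d (e l) (e l) = 1 \<or> e l i = 0"
          using norm[of l] ip_self_eq_0[of d "e l" i] that by auto
        then show "(\<Sum>j<k. c j * W j l) * e l i = w l * e l i"
          by (auto simp: w_def)
      qed
      finally show ?thesis .
    qed
    have coord: "ip d (e l) a = w l" if "l < k" for l
    proof -
      have "ip d (e l) a = ip d (\<lambda>i. \<Sum>j<k. w j * e j i) (e l)"
        by (subst ip_commute) (rule ip_cong, simp_all add: a)
      also have "\<dots> = (\<Sum>j<k. if j = l then w l * ip d (e l) (e l) else 0)"
        unfolding ip_sum_left ip_scale_left using orth that by (intro sum.cong) auto
      also have "\<dots> = w l" using that norm[OF that] by (auto simp: w_def)
      finally show ?thesis .
    qed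
    have "ip d a a = ip d (\<lambda>i. \<Sum>j<k. w j * e j i) a"
      by (rule ip_cong) (simp_all add: a)
    also have "\<dots> = (\<Sum>j<k. (w j)\<^sup>2)"
      unfolding ip_sum_left ip_scale_left by (intro sum.cong) (auto simp: coord power2_eq_square)
    finally show "\<exists>w. (\<forall>i<d. a i = (\<Sum>j<k. w j * e j i)) \<and> (\<Sum>j<k. (w j)\<^sup>2) \<le> ip d a a"
      using a by (intro exI[of _ w]) simp
  qed
qed

text \<open>If \<open>\<surd>T\<close> times an orthonormal basis of the subspace is added to the design first, the potential
  of these \<open>k\<close> vectors is at most \<open>(1 + C\<^sup>2 T)\<^sup>k\<close>, and every later vector has squared norm at most \<open>1 / T\<close>.\<close>
lemma elliptic_potential:
  assumes "in_subspace_dim d k (x ` S)" "S \<subseteq> {1..T}" "C > 0" "T \<ge> 1"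
    and x: "\<And>t. t \<in> S \<Longrightarrow> ip d (x t) (x t) \<le> 1"
  shows "(\<Sum>s\<in>S. ln (1 + inv_ip d (Mmat C x (S \<inter> {1..<s})) (x s) (x s))) \<le> k * ln (1 + C\<^sup>2 * T) + 1"
proof -
  define N :: "nat \<Rightarrow> nat \<Rightarrow> real" where "N = (\<lambda>i j. if i = j then 1 / C^2 else 0)"
  have r: "ridge (1 / C^2) N" unfolding N_def by (rule ridge_base)
  have c: "1 / C^2 > 0" using assms by simp
  have "finite S" using assms finite_subset by blast
  obtain e where e: "\<And>j. j < k \<Longrightarrow> ip d (e j) (e j) \<le> 1"
    and span: "\<And>a. a \<in> x ` S \<Longrightarrow> \<exists>w. (\<forall>i<d. a i = (\<Sum>j<k. w j * e j i)) \<and> (\<Sum>j<k. (w j)\<^sup>2) \<le> ip d a a"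
    using orthonormal_coordinates[OF assms(1)] by blast
  define f where "f = (\<lambda>j i. sqrt T * e j i)"
  have f: "ip d (f j) (f j) / (1 / C^2) \<le> C\<^sup>2 * T" if "j < k" for j
    using e[OF that] unfolding f_def ip_scale_left ip_scale_right
    by (simp add: mult.commute[of _ "C\<^sup>2"] mult.assoc[symmetric] mult_left_le)
  have small: "inv_ip d (gmat (gmat N f {..<k}) x A) (x s) (x s) \<le> 1 / T" if s: "s \<in> S" and A: "finite A" for s A
  proof -
    obtain w where w: "\<And>i. i < d \<Longrightarrow> x s i = (\<Sum>j<k. w j * e j i)" "(\<Sum>j<k. (w j)\<^sup>2) \<le> ip d (x s) (x s)"
      using span[of "x s"] s by blast
    have "inv_ip d (gmat (gmat N f {..<k}) x A) (x s) (x s) \<le> (\<Sum>j<k. (w j / sqrt T)\<^sup>2)"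
      using w(1) \<open>T \<ge> 1\<close> by (intro inv_ip_gmat_span_le[OF r c A]) (simp add: f_def)
    also have "\<dots> = (\<Sum>j<k. (w j)\<^sup>2) / T"
      by (simp add: power_divide sum_divide_distrib)
    also have "\<dots> \<le> 1 / T"
      using w(2) x[OF s] by (intro divide_right_mono) auto
    finally show ?thesis .
  qed
  have S: "S \<inter> {1..T} = S" using assms by auto
  have rf: "ridge (1 / C^2) (gmat N f {..<k})" using r by (simp add: ridge_gmat)
  have pos: "1 + inv_ip d (gmat N x (S \<inter> {1..<s})) (x s) (x s) > 0" for s
    using inv_ip_nonneg[OF ridge_gmat[OF r, of "S \<inter> {1..<s}" x] c, of d "x s"] \<open>finite S\<close> by simp
  \<comment> \<open>With the basis in the design every factor is at most 1 + 1/T, and there are at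
    most \<open>T\<close> of them, so the product is at most e. This is the origin of the final
    summand 1.\<close>
  have "potential d x S (gmat N f {..<k}) T \<le> (\<Prod>s\<in>S. 1 + 1 / T)"
    unfolding potential_def S
    using small \<open>finite S\<close> inv_ip_nonneg[OF ridge_gmat[OF rf] c]
    by (intro prod_mono) (simp add: add_nonneg_nonneg)
  also have "\<dots> \<le> (\<Prod>s\<in>S. exp (1 / T))"
    by (intro prod_mono) (auto simp: add_nonneg_nonneg)
  also have "\<dots> = exp (card S / T)" by (simp add: exp_of_nat_mult[symmetric])
  also have "\<dots> \<le> exp 1"
    using card_mono[OF _ assms(2)] \<open>T \<ge> 1\<close> by (simp add: divide_le_eq)
  finally have "potential d x S (gmat N f {..<k}) T \<le> exp 1" .
  moreover have "potential d x S N T \<le> (1 + C\<^sup>2 * T) ^ k * potential d x S (gmat N f {..<k}) T"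
    using potential_le_gmat[OF r c f] assms by simp
  ultimately have "potential d x S N T \<le> (1 + C\<^sup>2 * T) ^ k * exp 1"
    by (smt (verit) mult_left_mono zero_le_power zero_le_power2 mult_nonneg_nonneg of_nat_0_le_iff)
  moreover have P: "potential d x S N T > 0"
    unfolding potential_def S using pos by (intro prod_pos) auto
  ultimately have "ln (potential d x S N T) \<le> ln ((1 + C\<^sup>2 * T) ^ k * exp 1)"
    by (subst ln_le_cancel_iff) auto
  also have "\<dots> = k * ln (1 + C\<^sup>2 * T) + 1"
  proof -
    have "1 + C\<^sup>2 * T > 0" by (simp add: add_pos_nonneg)
    then show ?thesis by (simp add: ln_mult ln_realpow)
  qed
  also have "ln (potential d x S N T) = (\<Sum>s\<in>S. ln (1 + inv_ip d (gmat N x (S \<inter> {1..<s})) (x s) (x s)))"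
    unfolding potential_def S by (rule ln_prod[OF \<open>finite S\<close> pos[THEN less_imp_neq, THEN not_sym]])
  finally show ?thesis by (simp add: Mmat_eq_gmat N_def)
qed

section \<open>Prediction error and uncertainty sums\<close>

text \<open>The coefficient of the label of round \<open>s\<close> in the unclipped prediction at
  round \<open>t\<close>. It depends on the design only, which makes the noise part a linear form
  with fixed coefficients once the queried set is fixed.\<close>

definition noise_weight :: "nat \<Rightarrow> real \<Rightarrow> (nat \<Rightarrow> nat \<Rightarrow> real) \<Rightarrow> nat set \<Rightarrow> nat \<Rightarrow> nat \<Rightarrow> real" where
  "noise_weight d C x S t s = ip d (x s) (msolve d (Mmat C x S) (x t))"

definition query_prob :: "nat \<Rightarrow> real \<Rightarrow> real \<Rightarrow> real \<Rightarrow> (nat \<Rightarrow> nat \<Rightarrow> real) \<Rightarrow> nat set \<Rightarrow> nat \<Rightarrow> real" where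
  "query_prob d C eta alpha x S t = min 1 (alpha * delta d C eta x S t)"

lemma delta_eq: "delta d C eta x S t = (etat eta)\<^sup>2 * min 1 (inv_ip d (Mmat C x S) (x t) (x t))"
  by (simp add: delta_def inv_ip_def)

lemma etat_ge_1: "1 \<le> etat eta"
  by (simp add: etat_def)

lemma inv_ip_Mmat_nonneg: "finite S \<Longrightarrow> C > 0 \<Longrightarrow> 0 \<le> inv_ip d (Mmat C x S) a a"
  by (rule inv_ip_nonneg[OF ridge_Mmat]) auto

lemma delta_nonneg: "finite S \<Longrightarrow> C > 0 \<Longrightarrow> 0 \<le> delta d C eta x S t"
  unfolding delta_eq by (simp add: inv_ip_Mmat_nonneg)

lemma query_prob_bounds:
  assumes "finite S" "C > 0" "alpha > 0"
  shows "0 \<le> query_prob d C eta alpha x S t" "query_prob d C eta alpha x S t \<le> 1"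
  using delta_nonneg[OF assms(1,2)] assms(3) by (simp_all add: query_prob_def)

lemma estimate_eq:
  assumes "finite S" "C > 0"
  shows "ip d (msolve d (Mmat C x S) (\<lambda>i. \<Sum>s\<in>S. x s i * y s)) (x t)
    = (\<Sum>s\<in>S. noise_weight d C x S t s * y s)"
proof -
  have "ip d (msolve d (Mmat C x S) (\<lambda>i. \<Sum>s\<in>S. x s i * y s)) (x t)
      = inv_ip d (Mmat C x S) (\<lambda>i. \<Sum>s\<in>S. x s i * y s) (x t)"
    unfolding ip_commute[of d _ "x t"] inv_ip_def[symmetric]
    by (rule inv_ip_symmetric[OF ridge_Mmat[OF assms(1)]]) (use assms(2) in simp)
  also have "\<dots> = (\<Sum>s\<in>S. noise_weight d C x S t s * y s)"
    unfolding inv_ip_def noise_weight_def ip_sum_left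
    by (simp add: ip_def sum_distrib_left mult_ac)
  finally show ?thesis .
qed

text \<open>Expands w^T M w for w = M^-1 x_t. The regulariser term controls the bias of the
  prediction, the sum over \<open>S\<close> its variance.\<close>

lemma inv_ip_Mmat_self:
  assumes "finite S" "C > 0"
  shows "inv_ip d (Mmat C x S) (x t) (x t) =
    ip d (msolve d (Mmat C x S) (x t)) (msolve d (Mmat C x S) (x t)) / C\<^sup>2
      + (\<Sum>s\<in>S. (noise_weight d C x S t s)\<^sup>2)"
proof -
  have "1 / C\<^sup>2 > 0" using assms by simp
  from inv_ip_self[OF ridge_Mmat[OF assms(1)] this] show ?thesis
    by (simp add: ip_mv_Mmat[OF assms(1)] noise_weight_def power2_eq_square)
qed

lemma noise_weight_sum_le:
  assumes "finite S" "C > 0"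
  shows "(\<Sum>s\<in>S. (noise_weight d C x S t s)\<^sup>2) \<le> inv_ip d (Mmat C x S) (x t) (x t)"
  using ip_self_nonneg[of d] by (simp add: inv_ip_Mmat_self[OF assms])

text \<open>Writing <theta, x_t> as theta^T M w with w = M^-1 x_t cancels the noise-free labels and
  leaves the bias <theta, w> / C^2. As theta has norm at most \<open>C\<close>, this is at most |w|
  / C, which the regulariser term of \<open>inv_ip_Mmat_self\<close> bounds.\<close>

lemma estimate_error:
  assumes "finite S" "C > 0" "sqrt (ip d theta theta) \<le> C"
  shows "\<bar>(\<Sum>s\<in>S. noise_weight d C x S t s * (ip d theta (x s) + \<xi> s)) - ip d theta (x t)\<bar>
    \<le> sqrt (inv_ip d (Mmat C x S) (x t) (x t)) + \<bar>\<Sum>s\<in>S. noise_weight d C x S t s * \<xi> s\<bar>"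
proof -
  define w where "w = msolve d (Mmat C x S) (x t)"
  have "1 / C\<^sup>2 > 0" using assms by simp
  from ip_mv_msolve[OF ridge_Mmat[OF assms(1)] this, of d theta x "x t"]
  have "ip d theta (x t) = ip d theta w / C\<^sup>2 + (\<Sum>s\<in>S. ip d (x s) theta * ip d (x s) w)"
    by (simp add: ip_mv_Mmat[OF assms(1)] w_def)
  then have eq: "(\<Sum>s\<in>S. noise_weight d C x S t s * (ip d theta (x s) + \<xi> s)) - ip d theta (x t)
      = (\<Sum>s\<in>S. noise_weight d C x S t s * \<xi> s) - ip d theta w / C\<^sup>2"
    by (simp add: noise_weight_def w_def algebra_simps sum.distrib ip_commute[of d theta "x _"])
  have "ip d theta theta \<le> C\<^sup>2"
    using assms(2,3) by (intro sqrt_le_D)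
  then have "(ip d theta w)\<^sup>2 \<le> C\<^sup>2 * ip d w w"
    by (intro order_trans[OF ip_Cauchy_Schwarz mult_right_mono] ip_self_nonneg)
  then have "(ip d theta w / C\<^sup>2)\<^sup>2 \<le> ip d w w / C\<^sup>2"
    using assms(2) by (simp add: power_divide field_simps power2_eq_square)
  also have "\<dots> \<le> inv_ip d (Mmat C x S) (x t) (x t)"
    by (simp add: inv_ip_Mmat_self[OF assms(1,2)] w_def sum_nonneg)
  finally have "\<bar>ip d theta w / C\<^sup>2\<bar> \<le> sqrt (inv_ip d (Mmat C x S) (x t) (x t))"
    by (intro real_le_rsqrt) (simp add: power_divide)
  then show ?thesis unfolding eq by linarith
qed

lemma clip_error_le:
  assumes "\<bar>b\<bar> \<le> 1"
  shows "\<bar>clip a - b\<bar> \<le> \<bar>a - b\<bar>" "\<bar>clip a - b\<bar> \<le> 2"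
  using assms by (auto simp: clip_def min_def max_def)

text \<open>Since \<open>\<Gamma> * etat eta\<close> is at least 1, the bias is no larger than the
  noise bound, and the two together cost a factor 2, hence 4 after squaring.\<close>

lemma prediction_error:
  assumes "finite S" "C > 0" "sqrt (ip d theta theta) \<le> C" "\<bar>ip d theta (x t)\<bar> \<le> 1" "\<Gamma> \<ge> 1"
    and noise: "\<bar>\<Sum>s\<in>S. noise_weight d C x S t s * \<xi> s\<bar>
      \<le> \<Gamma> * (etat eta * sqrt (inv_ip d (Mmat C x S) (x t) (x t)))"
  shows "(clip (\<Sum>s\<in>S. noise_weight d C x S t s * (ip d theta (x s) + \<xi> s)) - ip d theta (x t))\<^sup>2
    \<le> 4 * \<Gamma>\<^sup>2 * delta d C eta x S t"
proof -
  define z where "z = inv_ip d (Mmat C x S) (x t) (x t)"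
  define e where "e = clip (\<Sum>s\<in>S. noise_weight d C x S t s * (ip d theta (x s) + \<xi> s)) - ip d theta (x t)"
  have z: "z \<ge> 0" unfolding z_def by (rule inv_ip_Mmat_nonneg[OF assms(1,2)])
  define g where "g = \<Gamma> * etat eta"
  have g: "1 \<le> g" using assms(5) etat_ge_1[of eta] mult_mono[of 1 \<Gamma> 1 "etat eta"] by (simp add: g_def)
  have "\<bar>e\<bar> \<le> sqrt z + \<bar>\<Sum>s\<in>S. noise_weight d C x S t s * \<xi> s\<bar>"
    unfolding e_def z_def by (rule order_trans[OF clip_error_le(1)[OF assms(4)] estimate_error[OF assms(1-3), of x t \<xi>]])
  also have "\<dots> \<le> sqrt z + g * sqrt z"
    using noise by (simp add: g_def z_def mult.assoc)
  also have "\<dots> \<le> 2 * g * sqrt z"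
    using mult_right_mono[OF g, of "sqrt z"] z by simp
  finally have "e\<^sup>2 \<le> (2 * g * sqrt z)\<^sup>2"
    by (metis abs_ge_zero power2_abs power_mono)
  then have 1: "e\<^sup>2 \<le> 4 * g\<^sup>2 * z" using z by (simp add: power_mult_distrib)
  \<comment> \<open>Clipping gives the first bound with \<open>z\<close> replaced by 1; the two
    bounds together yield the truncation \<open>min 1 z\<close> in \<open>delta\<close>.\<close>
  have "\<bar>e\<bar> \<le> 2 * g"
    unfolding e_def using g by (intro order_trans[OF clip_error_le(2)[OF assms(4)]]) simp
  then have "e\<^sup>2 \<le> (2 * g)\<^sup>2"
    by (metis abs_ge_zero power2_abs power_mono)
  then have 2: "e\<^sup>2 \<le> 4 * g\<^sup>2 * 1" by (simp add: power_mult_distrib)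
  have "e\<^sup>2 \<le> 4 * g\<^sup>2 * min 1 z" using 1 2 by (simp add: min_def)
  then show ?thesis by (simp add: e_def g_def z_def delta_eq power_mult_distrib mult.assoc)
qed

section \<open>From weighted uncertainty to query and uncertainty sums\<close>

lemma sum_le_sqrt_card:
  fixes f :: "'a \<Rightarrow> real"
  shows "(\<Sum>t\<in>A. f t) \<le> sqrt (card A * (\<Sum>t\<in>A. (f t)\<^sup>2))"
  using Cauchy_Schwarz_ineq_sum[of "\<lambda>_. 1" f A] by (intro real_le_rsqrt) simp

lemma sum_min_le:
  fixes D :: "'a \<Rightarrow> real" and alpha V :: real
  assumes "alpha > 0" "\<And>t. t \<in> A \<Longrightarrow> D t \<ge> 0" "(\<Sum>t\<in>A. min 1 (alpha * D t) * D t) \<le> V"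
  shows "(\<Sum>t\<in>A. min 1 (alpha * D t)) \<le> sqrt (card A * (alpha * V))"
    and "(\<Sum>t\<in>A. D t) \<le> V + sqrt (card A * (V / alpha))"
proof -
  have "(\<Sum>t\<in>A. (min 1 (alpha * D t))\<^sup>2) \<le> (\<Sum>t\<in>A. alpha * (min 1 (alpha * D t) * D t))"
  proof (rule sum_mono)
    fix t assume "t \<in> A"
    then have "0 \<le> min 1 (alpha * D t)" using assms by simp
    then have "min 1 (alpha * D t) * min 1 (alpha * D t) \<le> min 1 (alpha * D t) * (alpha * D t)"
      by (intro mult_left_mono) auto
    then show "(min 1 (alpha * D t))\<^sup>2 \<le> alpha * (min 1 (alpha * D t) * D t)"
      by (simp add: power2_eq_square mult.left_commute)
  qed
  also have "\<dots> \<le> alpha * V"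
    using assms by (simp add: sum_distrib_left[symmetric])
  finally show "(\<Sum>t\<in>A. min 1 (alpha * D t)) \<le> sqrt (card A * (alpha * V))"
    using sum_le_sqrt_card[where f = "\<lambda>t. min 1 (alpha * D t)" and A = A]
    by (meson mult_left_mono of_nat_0_le_iff order_trans real_sqrt_le_mono)
  have "(\<Sum>t\<in>A. D t) \<le> (\<Sum>t\<in>A. min 1 (alpha * D t) * D t + sqrt (min 1 (alpha * D t) * D t / alpha))"
  proof (rule sum_mono)
    fix t assume t: "t \<in> A"
    show "D t \<le> min 1 (alpha * D t) * D t + sqrt (min 1 (alpha * D t) * D t / alpha)"
    \<comment> \<open>If the probability is truncated to 1, the first summand is already
      \<open>D t\<close>; otherwise the expression under the root is the square of
      \<open>D t\<close>.\<close>
    proof (cases "alpha * D t \<ge> 1")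
      case True
      then show ?thesis using assms(1) assms(2)[OF t] by simp
    next
      case False
      then show ?thesis using assms(1) assms(2)[OF t] by simp
    qed
  qed
  also have "\<dots> \<le> V + sqrt (card A * (\<Sum>t\<in>A. (sqrt (min 1 (alpha * D t) * D t / alpha))\<^sup>2))"
    unfolding sum.distrib by (intro add_mono assms(3) sum_le_sqrt_card)
  also have "(\<Sum>t\<in>A. (sqrt (min 1 (alpha * D t) * D t / alpha))\<^sup>2) = (\<Sum>t\<in>A. min 1 (alpha * D t) * D t) / alpha"
    using assms(1,2) by (simp add: sum_divide_distrib)
  also have "V + sqrt (card A * ((\<Sum>t\<in>A. min 1 (alpha * D t) * D t) / alpha)) \<le> V + sqrt (card A * (V / alpha))"
    using assms(1,3) by (simp add: divide_right_mono mult_left_mono)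
  finally show "(\<Sum>t\<in>A. D t) \<le> V + sqrt (card A * (V / alpha))" .
qed

text \<open>Up to 1 this follows from 1 - 1/(1 + y) \<le> ln (1 + y); beyond 1 the left side is
  constant and the logarithm grows. It turns truncated norms into the logarithmic terms of the
  potential.\<close>

lemma min_1_le_ln:
  assumes "0 \<le> (z::real)"
  shows "min 1 z \<le> 2 * ln (1 + z)"
proof -
  have *: "y / 2 \<le> ln (1 + y)" if "0 \<le> y" "y \<le> 1" for y :: real
  proof -
    have "y / 2 \<le> y / (1 + y)" using that by (simp add: field_simps mult_left_le)
    also have "\<dots> = 1 - 1 / (1 + y)" using that by (simp add: field_simps)
    also have "\<dots> \<le> - ln (1 / (1 + y))"
      using ln_le_minus_one[of "1 / (1 + y)"] that by simp
    also have "\<dots> = ln (1 + y)" using that by (simp add: ln_div)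
    finally show ?thesis .
  qed
  show ?thesis
  proof (cases "z \<le> 1")
    case True
    then show ?thesis using *[OF assms] by simp
  next
    case False
    then have "ln 2 \<le> ln (1 + z)" by simp
    moreover have "1 / 2 \<le> ln (2::real)" using *[of 1] by simp
    ultimately have "1 \<le> 2 * ln (1 + z)" by linarith
    then show ?thesis using False by simp
  qed
qed

text \<open>Dropping the queries outside \<open>A\<close> from the design only increases the norms, so the potential
  argument can be run inside the subspace containing \<open>A\<close>.\<close>
lemma subspace_potential:
  assumes "in_subspace_dim d k (x ` A)" "A \<subseteq> {1..T}" "C > 0" "T \<ge> 1" "finite S"
    and "\<And>t. t \<in> A \<Longrightarrow> ip d (x t) (x t) \<le> 1"
  shows "(\<Sum>t\<in>A \<inter> S. min 1 (inv_ip d (Mmat C x (S \<inter> {1..<t})) (x t) (x t)))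
    \<le> 2 * (k * ln (1 + C\<^sup>2 * T) + 1)"
proof -
  have sub: "in_subspace_dim d k (x ` (A \<inter> S))"
    using assms(1) unfolding in_subspace_dim_def by blast
  have "(\<Sum>t\<in>A \<inter> S. min 1 (inv_ip d (Mmat C x (S \<inter> {1..<t})) (x t) (x t)))
    \<le> (\<Sum>t\<in>A \<inter> S. 2 * ln (1 + inv_ip d (Mmat C x (A \<inter> S \<inter> {1..<t})) (x t) (x t)))"
  proof (rule sum_mono)
    fix t
    have "inv_ip d (Mmat C x (S \<inter> {1..<t})) (x t) (x t) \<le> inv_ip d (Mmat C x (A \<inter> S \<inter> {1..<t})) (x t) (x t)"
      unfolding Mmat_eq_gmat using assms(3,5)
      by (intro inv_ip_gmat_antimono[OF ridge_base]) auto
    then have "min 1 (inv_ip d (Mmat C x (S \<inter> {1..<t})) (x t) (x t))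
      \<le> min 1 (inv_ip d (Mmat C x (A \<inter> S \<inter> {1..<t})) (x t) (x t))"
      by (rule min.mono[OF order_refl])
    also have "\<dots> \<le> 2 * ln (1 + inv_ip d (Mmat C x (A \<inter> S \<inter> {1..<t})) (x t) (x t))"
      by (intro min_1_le_ln inv_ip_Mmat_nonneg assms(3)) simp
    finally show "min 1 (inv_ip d (Mmat C x (S \<inter> {1..<t})) (x t) (x t))
      \<le> 2 * ln (1 + inv_ip d (Mmat C x (A \<inter> S \<inter> {1..<t})) (x t) (x t))" .
  qed
  also have "\<dots> \<le> 2 * (k * ln (1 + C\<^sup>2 * T) + 1)"
    using elliptic_potential[OF sub _ assms(3,4)] assms(2,6) by (simp add: sum_distrib_left[symmetric] le_infI1)
  finally show ?thesis .
qed

section \<open>Law of the queried set\<close>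

lemma qset_subset: "qset d C eta alpha x U n \<subseteq> {1..n}"
  by (induction n) (auto simp: Let_def)

lemma qset_Int: "n \<le> T \<Longrightarrow> qset d C eta alpha x U T \<inter> {1..n} = qset d C eta alpha x U n"
proof (induction T)
  case (Suc T)
  show ?case
  proof (cases "n = Suc T")
    case True
    then show ?thesis using qset_subset by blast
  next
    case False
    then have "n \<le> T" using Suc.prems by simp
    then show ?thesis using Suc.IH by (auto simp: Let_def)
  qed
qed simp

text \<open>Once the final set \<open>S\<close> is fixed, the coin thresholds are constants. The
  adaptive event becomes a conjunction of conditions on single coins, to which independence
  applies.\<close>

lemma qset_eq_iff:
  "qset d C eta alpha x U n = S \<inter> {1..n} \<longleftrightarrow>
   (\<forall>t\<in>{1..n}. U t < query_prob d C eta alpha x (S \<inter> {1..<t}) t \<longleftrightarrow> t \<in> S)"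
proof (induction n)
  case (Suc n)
  have *: "{1..<Suc n} = {1..n}" and 3: "{1..Suc n} = insert (Suc n) {1..n}" by auto
  have "qset d C eta alpha x U (Suc n) = S \<inter> {1..Suc n} \<longleftrightarrow>
    qset d C eta alpha x U n = S \<inter> {1..n} \<and> (Suc n \<in> qset d C eta alpha x U (Suc n) \<longleftrightarrow> Suc n \<in> S)"
    (is "?A = S \<inter> {1..Suc n} \<longleftrightarrow> ?B = S \<inter> {1..n} \<and> (Suc n \<in> ?A \<longleftrightarrow> Suc n \<in> S)")
  proof -
    have 1: "?A \<inter> {1..n} = ?B" by (rule qset_Int) simp
    have 2: "?A \<subseteq> {1..Suc n}" by (rule qset_subset)
    show ?thesis using 1 2 unfolding 3 by blast
  qed
  also have "\<dots> \<longleftrightarrow> qset d C eta alpha x U n = S \<inter> {1..n} \<and>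
      (U (Suc n) < query_prob d C eta alpha x (S \<inter> {1..<Suc n}) (Suc n) \<longleftrightarrow> Suc n \<in> S)"
    using qset_subset[of d C eta alpha x U n] unfolding * by (auto simp: Let_def query_prob_def)
  also have "\<dots> \<longleftrightarrow> (\<forall>t\<in>{1..Suc n}. U t < query_prob d C eta alpha x (S \<inter> {1..<t}) t \<longleftrightarrow> t \<in> S)"
    unfolding Suc.IH 3 ball_simps by blast
  finally show ?case .
qed simp

text \<open>A supermartingale argument without conditional expectations: subsets of
  \<open>{1..n}\<close> are the histories, and \<open>k\<close> is a nonnegative kernel whose two
  branches have total mass at most 1.\<close>

lemma sum_prod_history_le_1:
  fixes k :: "nat \<Rightarrow> nat set \<Rightarrow> bool \<Rightarrow> real"
  assumes "\<And>t R b. finite R \<Longrightarrow> 0 \<le> k t R b" "\<And>t R. finite R \<Longrightarrow> k t R True + k t R False \<le> 1"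
  shows "(\<Sum>S\<in>Pow {1..n}. \<Prod>t\<in>{1..n}. k t (S \<inter> {1..<t}) (t \<in> S)) \<le> 1"
proof (induction n)
  case (Suc n)
  define F where "F m S = (\<Prod>t\<in>{1..m}. k t (S \<inter> {1..<t}) (t \<in> S))" for m S
  have *: "{1..Suc n} = insert (Suc n) {1..n}" "{1..<Suc n} = {1..n}" by auto
  have F_Suc: "F (Suc n) S = k (Suc n) (S \<inter> {1..n}) (Suc n \<in> S) * F n S" for S
    unfolding F_def by (subst *(1), subst prod.insert) (auto simp: *(2)[unfolded One_nat_def])
  have F_insert: "F n (insert (Suc n) S) = F n S" for S
    unfolding F_def by (intro prod.cong refl arg_cong2[where f = "k _"]) auto
  have F_nonneg: "0 \<le> F n S" for S
    unfolding F_def by (intro prod_nonneg) (simp add: assms(1))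
  \<comment> \<open>Histories are paired according to whether they contain the last round; the
    earlier factors agree on each pair because they see only earlier rounds.\<close>
  have "(\<Sum>S\<in>Pow {1..Suc n}. F (Suc n) S) =
    (\<Sum>S\<in>Pow {1..n}. F (Suc n) S) + (\<Sum>S\<in>insert (Suc n) ` Pow {1..n}. F (Suc n) S)"
    unfolding *(1) Pow_insert by (rule sum.union_disjoint) auto
  also have "(\<Sum>S\<in>insert (Suc n) ` Pow {1..n}. F (Suc n) S) = (\<Sum>S\<in>Pow {1..n}. F (Suc n) (insert (Suc n) S))"
  proof (rule sum.reindex[unfolded comp_def], rule inj_onI)
    fix R S assume "R \<in> Pow {1..n}" "S \<in> Pow {1..n}" and eq: "insert (Suc n) R = insert (Suc n) S"
    then have "Suc n \<notin> R" "Suc n \<notin> S" by auto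
    then show "R = S" using eq by (simp add: insert_ident)
  qed
  also have "(\<Sum>S\<in>Pow {1..n}. F (Suc n) S) + (\<Sum>S\<in>Pow {1..n}. F (Suc n) (insert (Suc n) S))
    = (\<Sum>S\<in>Pow {1..n}. (k (Suc n) S True + k (Suc n) S False) * F n S)"
    unfolding sum.distrib[symmetric]
  proof (intro sum.cong refl)
    fix S assume "S \<in> Pow {1..n}"
    then have "S \<inter> {1..n} = S" "insert (Suc n) S \<inter> {1..n} = S" "Suc n \<notin> S" by auto
    then show "F (Suc n) S + F (Suc n) (insert (Suc n) S) = (k (Suc n) S True + k (Suc n) S False) * F n S"
      by (simp add: F_Suc F_insert distrib_right)
  qed
  also have "\<dots> \<le> (\<Sum>S\<in>Pow {1..n}. 1 * F n S)"
    by (intro sum_mono mult_right_mono assms(2) F_nonneg) (auto intro: finite_subset)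
  also have "\<dots> \<le> 1" using Suc.IH by (simp add: F_def)
  finally show ?case by (simp add: F_def)
qed simp

text \<open>The probability, for \<open>S\<close> within \<open>{1..T}\<close>, that the coins
  produce exactly the queried set \<open>S\<close>. It reduces expectations over the coins to finite
  sums.\<close>

definition qset_prob :: "nat \<Rightarrow> real \<Rightarrow> real \<Rightarrow> real \<Rightarrow> (nat \<Rightarrow> nat \<Rightarrow> real) \<Rightarrow> nat \<Rightarrow> nat set \<Rightarrow> real" where
  "qset_prob d C eta alpha x T S =
     (\<Prod>t\<in>{1..T}. if t \<in> S then query_prob d C eta alpha x (S \<inter> {1..<t}) t
                   else 1 - query_prob d C eta alpha x (S \<inter> {1..<t}) t)"

lemma qset_prob_nonneg:
  assumes "C > 0" "alpha > 0"
  shows "0 \<le> qset_prob d C eta alpha x T S"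
  unfolding qset_prob_def using query_prob_bounds[OF _ assms] by (intro prod_nonneg) auto

text \<open>The exponential supermartingale bound: the hypothesis says that, given the past queries
  \<open>R\<close>, the exponential of the next increment has mean at most 1.\<close>

lemma sum_qset_prob_exp_le_1:
  fixes g :: "nat \<Rightarrow> nat set \<Rightarrow> bool \<Rightarrow> real"
  assumes "C > 0" "alpha > 0"
    and "\<And>t R. finite R \<Longrightarrow> query_prob d C eta alpha x R t * exp (g t R True)
      + (1 - query_prob d C eta alpha x R t) * exp (g t R False) \<le> 1"
  shows "(\<Sum>S\<in>Pow {1..T}. qset_prob d C eta alpha x T S
    * exp (\<Sum>t\<in>{1..T}. g t (S \<inter> {1..<t}) (t \<in> S))) \<le> 1"
proof -
  define k where "k t R b = (if b then query_prob d C eta alpha x R t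
      else 1 - query_prob d C eta alpha x R t) * exp (g t R b)" for t R b
  have "(\<Sum>S\<in>Pow {1..T}. \<Prod>t\<in>{1..T}. k t (S \<inter> {1..<t}) (t \<in> S)) \<le> 1"
    using assms(3) query_prob_bounds[OF _ assms(1,2)] by (intro sum_prod_history_le_1) (auto simp: k_def)
  then show ?thesis
    unfolding k_def prod.distrib qset_prob_def exp_sum[OF finite_atLeastAtMost] .
qed

lemma sum_qset_prob_le_1:
  assumes "C > 0" "alpha > 0"
  shows "(\<Sum>S\<in>Pow {1..T}. qset_prob d C eta alpha x T S) \<le> 1"
  using sum_qset_prob_exp_le_1[OF assms, where g = "\<lambda>_ _ _. 0"] by simp

section \<open>Coins and noise on the sample space\<close>

lemma (in prob_space) expectation_uniform_less:
  assumes U: "random_variable borel U" "distr M borel U = uniform_measure lborel {0..1::real}"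
    and "0 \<le> p" "p \<le> 1"
  shows "expectation (\<lambda>\<omega>. of_bool (U \<omega> < p \<longleftrightarrow> b)) = (if b then p else 1 - p)"
proof -
  have "prob {\<omega> \<in> space M. U \<omega> < p} = measure (distr M borel U) {..<p}"
    by (subst measure_distr[OF U(1)]) (auto intro: arg_cong[where f = prob])
  also have "\<dots> = measure lborel ({0..1} \<inter> {..<p}) / measure lborel {0..1::real}"
    unfolding U(2) by (rule measure_uniform_measure) auto
  also have "{0..1} \<inter> {..<p} = {0..<p}" using assms by auto
  finally have p: "prob {\<omega> \<in> space M. U \<omega> < p} = p" using assms by simp
  note [measurable] = U(1)
  have e: "expectation (\<lambda>\<omega>. of_bool (U \<omega> < p)) = p"
  proof -
    have "expectation (\<lambda>\<omega>. of_bool (U \<omega> < p)) = expectation (indicat_real {\<omega> \<in> space M. U \<omega> < p})"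
      by (intro Bochner_Integration.integral_cong) (auto simp: indicator_def)
    then show ?thesis using p by simp
  qed
  show ?thesis
  proof (cases b)
    case False
    have "integrable M (\<lambda>\<omega>. of_bool (U \<omega> < p) :: real)"
      by (rule integrable_const_bound[of _ 1]) auto
    then have "expectation (\<lambda>\<omega>. 1 - of_bool (U \<omega> < p)) = 1 - p"
      using e by (simp add: prob_space)
    then show ?thesis using False by (simp add: of_bool_not_iff)
  qed (use e in simp)
qed

text \<open>For a fixed set \<open>S\<close> the integrand is a product of functions of single coins
  and single noise variables. Independence factors its mean into coin probabilities and sub-Gaussian
  moment bounds.\<close>

lemma noise_model_qset_exp:
  fixes d :: nat and x :: "nat \<Rightarrow> nat \<Rightarrow> real" and c :: "nat \<Rightarrow> real"
  assumes M: "noise_model M eta T" and "C > 0" "alpha > 0" "S \<subseteq> {1..T}"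
  defines "f \<equiv> (\<lambda>\<omega>. of_bool (qset d C eta alpha x (snd \<omega>) T = S) * exp (\<Sum>s\<in>{1..T}. c s * fst \<omega> s) :: real)"
  shows "integrable M f"
    and "integral\<^sup>L M f \<le> qset_prob d C eta alpha x T S * exp (eta\<^sup>2 / 2 * (\<Sum>s\<in>{1..T}. (c s)\<^sup>2))"
proof -
  interpret prob_space M using M by (simp add: noise_model_def)
  define X :: "nat + nat \<Rightarrow> omega \<Rightarrow> real"
    where "X = (\<lambda>i. case i of Inl t \<Rightarrow> (\<lambda>\<omega>. fst \<omega> t) | Inr t \<Rightarrow> (\<lambda>\<omega>. snd \<omega> t))"
  define J :: "(nat + nat) set" where "J = Inl ` {1..T} \<union> Inr ` {1..T}"
  define p where "p t = query_prob d C eta alpha x (S \<inter> {1..<t}) t" for t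
  define Y :: "nat + nat \<Rightarrow> real \<Rightarrow> real"
    where "Y = (\<lambda>i. case i of Inl t \<Rightarrow> (\<lambda>r. exp (c t * r)) | Inr t \<Rightarrow> (\<lambda>r. of_bool (r < p t \<longleftrightarrow> t \<in> S)))"
  have ind: "indep_vars (\<lambda>_. borel) X J"
    using M by (simp add: noise_model_def X_def J_def)
  have Y_meas: "Y i \<in> borel_measurable borel" for i
    by (cases i) (auto simp: Y_def)
  have indY: "indep_vars (\<lambda>_. borel) (\<lambda>i \<omega>. Y i (X i \<omega>)) J"
    by (rule indep_vars_compose2[OF ind]) (rule Y_meas)
  have noise: "integrable M (\<lambda>\<omega>. exp (c t * fst \<omega> t))"
      "expectation (\<lambda>\<omega>. exp (c t * fst \<omega> t)) \<le> exp (eta\<^sup>2 / 2 * (c t)\<^sup>2)" if "t \<in> {1..T}" for t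
  proof -
    have "\<forall>l. integrable M (\<lambda>\<omega>. exp (l * fst \<omega> t)) \<and>
        expectation (\<lambda>\<omega>. exp (l * fst \<omega> t)) \<le> exp (l\<^sup>2 * eta\<^sup>2 / 2)"
      using M that unfolding noise_model_def by blast
    from this[rule_format, of "c t"] show "integrable M (\<lambda>\<omega>. exp (c t * fst \<omega> t))"
      "expectation (\<lambda>\<omega>. exp (c t * fst \<omega> t)) \<le> exp (eta\<^sup>2 / 2 * (c t)\<^sup>2)"
      by (simp_all add: mult.commute)
  qed
  have coin: "(\<lambda>\<omega>. snd \<omega> t) \<in> borel_measurable M"
      "distr M borel (\<lambda>\<omega>. snd \<omega> t) = uniform_measure lborel {0..1}" if "t \<in> {1..T}" for t
    using M that by (auto simp: noise_model_def)
  have int: "integrable M (\<lambda>\<omega>. Y i (X i \<omega>))" if "i \<in> J" for i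
  proof (cases i)
    case (Inl t)
    then show ?thesis using that noise(1)[of t] by (auto simp: Y_def X_def J_def)
  next
    case (Inr t)
    then have t: "t \<in> {1..T}" using that by (auto simp: J_def)
    note [measurable] = coin(1)[OF t]
    show ?thesis unfolding Inr Y_def X_def sum.case
      by (rule integrable_const_bound[of _ 1]) auto
  qed
  have finJ: "finite J" by (simp add: J_def)
  have split: "(\<Prod>i\<in>J. h i) = (\<Prod>t\<in>{1..T}. h (Inl t)) * (\<Prod>t\<in>{1..T}. h (Inr t))" for h :: "nat + nat \<Rightarrow> real"
    unfolding J_def by (subst prod.union_disjoint) (auto simp: prod.reindex)
  have f: "f = (\<lambda>\<omega>. \<Prod>i\<in>J. Y i (X i \<omega>))"
  proof
    fix \<omega> :: omega
    have "(\<Prod>t\<in>{1..T}. of_bool (snd \<omega> t < p t \<longleftrightarrow> t \<in> S) :: real) = of_bool (\<forall>t\<in>{1..T}. snd \<omega> t < p t \<longleftrightarrow> t \<in> S)"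
      by (cases "\<forall>t\<in>{1..T}. snd \<omega> t < p t \<longleftrightarrow> t \<in> S") (auto intro!: prod_zero prod.neutral)
    moreover have "qset d C eta alpha x (snd \<omega>) T = S \<longleftrightarrow> (\<forall>t\<in>{1..T}. snd \<omega> t < p t \<longleftrightarrow> t \<in> S)"
      using qset_eq_iff[of d C eta alpha x "snd \<omega>" T S] assms(4) by (simp add: p_def Int_absorb2)
    ultimately show "f \<omega> = (\<Prod>i\<in>J. Y i (X i \<omega>))"
      unfolding f_def split by (simp add: Y_def X_def exp_sum mult.commute)
  qed
  show "integrable M f"
    unfolding f by (rule indep_vars_integrable[OF finJ indY int])
  have "integral\<^sup>L M f = (\<Prod>i\<in>J. expectation (\<lambda>\<omega>. Y i (X i \<omega>)))"
    unfolding f by (rule indep_vars_lebesgue_integral[OF finJ indY int])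
  also have "\<dots> = (\<Prod>t\<in>{1..T}. expectation (\<lambda>\<omega>. exp (c t * fst \<omega> t))) * qset_prob d C eta alpha x T S"
  proof -
    have "(\<Prod>t\<in>{1..T}. expectation (\<lambda>\<omega>. Y (Inr t) (X (Inr t) \<omega>))) = qset_prob d C eta alpha x T S"
      unfolding qset_prob_def p_def[symmetric]
    proof (intro prod.cong refl)
      fix t assume "t \<in> {1..T}"
      then show "expectation (\<lambda>\<omega>. Y (Inr t) (X (Inr t) \<omega>)) = (if t \<in> S then p t else 1 - p t)"
        unfolding Y_def X_def sum.case
        using query_prob_bounds[OF _ assms(2,3)] by (intro expectation_uniform_less coin) (auto simp: p_def)
    qed
    then show ?thesis unfolding split by (simp add: Y_def X_def)
  qed
  also have "\<dots> \<le> (\<Prod>t\<in>{1..T}. exp (eta\<^sup>2 / 2 * (c t)\<^sup>2)) * qset_prob d C eta alpha x T S"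
    by (intro mult_right_mono prod_mono conjI qset_prob_nonneg assms noise Bochner_Integration.integral_nonneg) auto
  also have "(\<Prod>t\<in>{1..T}. exp (eta\<^sup>2 / 2 * (c t)\<^sup>2)) = exp (eta\<^sup>2 / 2 * (\<Sum>s\<in>{1..T}. (c s)\<^sup>2))"
    by (simp add: exp_sum sum_distrib_left)
  finally show "integral\<^sup>L M f \<le> qset_prob d C eta alpha x T S * exp (eta\<^sup>2 / 2 * (\<Sum>s\<in>{1..T}. (c s)\<^sup>2))"
    by (simp add: mult.commute)
qed

text \<open>Coefficients may depend on the queried set, since the expectation is split over its
  possible values. One application of Markov's inequality to the sum of all exponentials replaces
  separate tail bounds.\<close>

lemma exponential_union_bound:
  fixes a :: "'k \<Rightarrow> nat set \<Rightarrow> real" and c :: "'k \<Rightarrow> nat set \<Rightarrow> nat \<Rightarrow> real"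
  assumes M: "noise_model M eta T" and "C > 0" "alpha > 0" "finite J" "r > 0"
    and le_1: "\<And>k. k \<in> J \<Longrightarrow> (\<Sum>S\<in>Pow {1..T}. qset_prob d C eta alpha x T S
        * exp (a k S + eta\<^sup>2 / 2 * (\<Sum>s\<in>{1..T}. (c k S s)\<^sup>2))) \<le> 1"
    and A: "A \<in> sets M" "\<And>\<omega>. \<omega> \<in> space M \<Longrightarrow>
      (\<And>k. k \<in> J \<Longrightarrow> a k (qset d C eta alpha x (snd \<omega>) T)
        + (\<Sum>s\<in>{1..T}. c k (qset d C eta alpha x (snd \<omega>) T) s * fst \<omega> s) \<le> ln r) \<Longrightarrow> \<omega> \<in> A"
  shows "measure M A \<ge> 1 - card J / r"
proof -
  interpret prob_space M using M by (simp add: noise_model_def)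
  let ?Q = "\<lambda>\<omega>. qset d C eta alpha x (snd \<omega>) T"
  define f :: "'k \<Rightarrow> nat set \<Rightarrow> omega \<Rightarrow> real"
    where "f = (\<lambda>k S \<omega>. of_bool (?Q \<omega> = S) * exp (\<Sum>s\<in>{1..T}. c k S s * fst \<omega> s))"
  \<comment> \<open>The indicators in \<open>f\<close> leave only the realised queried set, so
    \<open>G\<close> dominates each exponential evaluated at that set.\<close>
  define G where "G = (\<lambda>\<omega>. \<Sum>k\<in>J. \<Sum>S\<in>Pow {1..T}. exp (a k S) * f k S \<omega>)"
  have f: "integrable M (f k S)"
    "integral\<^sup>L M (f k S) \<le> qset_prob d C eta alpha x T S * exp (eta\<^sup>2 / 2 * (\<Sum>s\<in>{1..T}. (c k S s)\<^sup>2))"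
    if "S \<in> Pow {1..T}" for k S
    using noise_model_qset_exp[OF M assms(2,3), of S d x "c k S"] that by (auto simp: f_def)
  have G_int: "integrable M G" unfolding G_def
    by (intro Bochner_Integration.integrable_sum integrable_mult_right f(1))
  have f_nonneg: "f k S \<omega> \<ge> 0" for k S \<omega> by (simp add: f_def)
  have G_nonneg: "G \<omega> \<ge> 0" for \<omega> unfolding G_def by (intro sum_nonneg) (simp add: f_nonneg)
  have "expectation G = (\<Sum>k\<in>J. \<Sum>S\<in>Pow {1..T}. exp (a k S) * integral\<^sup>L M (f k S))"
    unfolding G_def using f by (subst Bochner_Integration.integral_sum) auto
  also have "\<dots> \<le> (\<Sum>k\<in>J. \<Sum>S\<in>Pow {1..T}. exp (a k S) *
      (qset_prob d C eta alpha x T S * exp (eta\<^sup>2 / 2 * (\<Sum>s\<in>{1..T}. (c k S s)\<^sup>2))))"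
    using f by (intro sum_mono mult_left_mono) auto
  also have "\<dots> \<le> (\<Sum>k\<in>J. 1)"
    using le_1 by (intro sum_mono) (simp add: exp_add mult_ac)
  finally have EG: "expectation G \<le> card J" by simp
  have "prob {\<omega> \<in> space M. G \<omega> \<ge> r} \<le> expectation G / r"
    using G_int G_nonneg \<open>r > 0\<close> by (intro integral_Markov_inequality_measure[of _ _ "{}"]) auto
  also have "\<dots> \<le> card J / r"
    using EG \<open>r > 0\<close> by (simp add: divide_right_mono)
  finally have bad: "prob {\<omega> \<in> space M. G \<omega> \<ge> r} \<le> card J / r" .
  have [measurable]: "G \<in> borel_measurable M" using G_int by simp
  have "1 - prob {\<omega> \<in> space M. G \<omega> \<ge> r} = prob (space M - {\<omega> \<in> space M. G \<omega> \<ge> r})"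
    by (subst prob_compl) auto
  also have "\<dots> \<le> prob A"
  proof (rule finite_measure_mono)
    show "space M - {\<omega> \<in> space M. G \<omega> \<ge> r} \<subseteq> A"
    proof
      fix \<omega> assume "\<omega> \<in> space M - {\<omega> \<in> space M. G \<omega> \<ge> r}"
      then have \<omega>: "\<omega> \<in> space M" "G \<omega> < r" by auto
      show "\<omega> \<in> A"
      proof (rule A(2)[OF \<omega>(1)])
        fix k assume k: "k \<in> J"
        have Q: "?Q \<omega> \<in> Pow {1..T}" using qset_subset by blast
        have "exp (a k (?Q \<omega>) + (\<Sum>s\<in>{1..T}. c k (?Q \<omega>) s * fst \<omega> s)) = exp (a k (?Q \<omega>)) * f k (?Q \<omega>) \<omega>"
          by (simp add: f_def exp_add)
        also have "\<dots> \<le> (\<Sum>S\<in>Pow {1..T}. exp (a k S) * f k S \<omega>)"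
          by (rule member_le_sum[OF Q]) (simp_all add: f_nonneg)
        also have "\<dots> \<le> G \<omega>"
          unfolding G_def by (rule member_le_sum[OF k]) (simp_all add: f_nonneg sum_nonneg assms(4))
        also have "\<dots> < r" by (rule \<omega>(2))
        finally show "a k (?Q \<omega>) + (\<Sum>s\<in>{1..T}. c k (?Q \<omega>) s * fst \<omega> s) \<le> ln r"
          using \<open>r > 0\<close> by (simp add: ln_ge_iff)
      qed
    qed
  qed (rule A(1))
  finally show ?thesis using bad by simp
qed

section \<open>Deterministic bounds on the good event\<close>

text \<open>For a coin of probability \<open>p\<close> and weight \<open>h\<close>, exp (-h) \<le>
  1/(1 + h) \<le> 1 - h/2 on the unit interval. Half of the mean is therefore enough compensation,
  which costs only a constant factor later.\<close>

lemma lower_tail_drift: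
  fixes p h :: real
  assumes "0 \<le> p" "p \<le> 1" "0 \<le> h" "h \<le> 1"
  shows "p * exp (p * h / 2 - h) + (1 - p) * exp (p * h / 2) \<le> 1"
proof -
  have "exp (- h) \<le> 1 / (1 + h)"
    using exp_ge_add_one_self[of h] assms by (simp add: exp_minus field_simps)
  also have "\<dots> \<le> 1 - h / 2"
  proof -
    have "h * h \<le> h" using assms by (simp add: mult_left_le)
    then have "1 \<le> (1 - h / 2) * (1 + h)" by (simp add: algebra_simps)
    then show ?thesis using assms by (simp add: divide_le_eq)
  qed
  finally have e: "p * (h / 2) \<le> p * (1 - exp (- h))" using assms by (intro mult_left_mono) auto
  have "p * exp (p * h / 2 - h) + (1 - p) * exp (p * h / 2) = exp (p * h / 2) * (1 + - (p * (1 - exp (- h))))"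
    by (simp add: exp_diff exp_minus algebra_simps inverse_eq_divide)
  also have "\<dots> \<le> exp (p * h / 2) * exp (- (p * (1 - exp (- h))))"
    by (intro mult_left_mono exp_ge_add_one_self) simp
  also have "\<dots> = exp (p * (h / 2) - p * (1 - exp (- h)))" by (simp add: exp_add[symmetric])
  also have "\<dots> \<le> 1" using e by simp
  finally show ?thesis .
qed

text \<open>Since e - 1 \<le> 2, twice the mean compensates the exponential moment of the
  coin.\<close>

lemma upper_tail_drift:
  fixes p :: real
  assumes "0 \<le> p"
  shows "p * exp (1 - 2 * p) + (1 - p) * exp (- 2 * p) \<le> 1"
proof -
  have "p * exp (1 - 2 * p) + (1 - p) * exp (- 2 * p) = exp (- 2 * p) * (1 + p * (exp 1 - 1))"
    by (simp add: exp_diff exp_minus field_simps)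
  also have "\<dots> \<le> exp (- 2 * p) * (1 + 2 * p)"
    using exp_le mult_left_mono[OF _ assms, of "exp 1 - 1" 2] by (intro mult_left_mono) auto
  also have "\<dots> \<le> exp (- 2 * p) * exp (2 * p)"
    by (intro mult_left_mono exp_ge_add_one_self) simp
  also have "\<dots> = 1" by (simp add: exp_add[symmetric])
  finally show ?thesis .
qed

text \<open>Expresses the regret through the final queried set alone: the set available at round
  \<open>t\<close> is its part strictly before \<open>t\<close>. Fixing that set thus fixes all
  weights.\<close>

lemma regret_eq:
  fixes U y :: "nat \<Rightarrow> real" and x :: "nat \<Rightarrow> nat \<Rightarrow> real" and d T :: nat and eta alpha :: real
  assumes "C > 0"
  defines "Q \<equiv> qset d C eta alpha x U T"
  shows "regret d C eta alpha x U y theta T = (\<Sum>t=1..T.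
    (clip (\<Sum>s\<in>Q \<inter> {1..<t}. noise_weight d C x (Q \<inter> {1..<t}) t s * y s) - ip d theta (x t))\<^sup>2)"
  unfolding regret_def
proof (intro sum.cong refl)
  fix t assume t: "t \<in> {1..T}"
  then have "{1..<t} = {1..t - 1}" by auto
  moreover have "t - 1 \<le> T" using t by auto
  ultimately have "qset d C eta alpha x U (t - 1) = Q \<inter> {1..<t}"
    using qset_Int[of "t - 1" T d C eta alpha x U] by (simp add: Q_def)
  then have "yhat d C eta alpha x U y t =
      clip (\<Sum>s\<in>Q \<inter> {1..<t}. noise_weight d C x (Q \<inter> {1..<t}) t s * y s)"
    unfolding yhat_def Let_def by (simp add: estimate_eq assms)
  then show "(yhat d C eta alpha x U y t - ip d theta (x t))\<^sup>2 =
      (clip (\<Sum>s\<in>Q \<inter> {1..<t}. noise_weight d C x (Q \<inter> {1..<t}) t s * y s) - ip d theta (x t))\<^sup>2"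
    by simp
qed

locale qufur =
  fixes d T :: nat and C eta \<delta> alpha :: real and theta :: "nat \<Rightarrow> real" and x :: "nat \<Rightarrow> nat \<Rightarrow> real"
    and m :: nat and I :: "nat \<Rightarrow> nat set" and du :: "nat \<Rightarrow> nat"
  assumes T: "T \<ge> 1" and C: "C > 0" and eta: "eta \<ge> 0" and \<delta>: "0 < \<delta>" "\<delta> < 1" and alpha: "alpha > 0"
    and theta: "sqrt (ip d theta theta) \<le> C"
    and x: "\<And>t. t \<in> {1..T} \<Longrightarrow> sqrt (ip d (x t) (x t)) \<le> 1"
    and theta_x: "\<And>t. t \<in> {1..T} \<Longrightarrow> \<bar>ip d theta (x t)\<bar> \<le> 1"
    and I_nonempty: "\<And>u. u \<in> {1..m} \<Longrightarrow> I u \<noteq> {}"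
    and I_disjoint: "\<And>u v. u \<in> {1..m} \<Longrightarrow> v \<in> {1..m} \<Longrightarrow> u \<noteq> v \<Longrightarrow> I u \<inter> I v = {}"
    and I_cover: "(\<Union>u\<in>{1..m}. I u) = {1..T}"
    and I_subspace: "\<And>u. u \<in> {1..m} \<Longrightarrow> in_subspace_dim d (du u) (x ` I u)"
begin

definition L :: real where
  "L = ln (exp 1 + real T) + ln (exp 1 + 1 / \<delta>) + ln (exp 1 + C)"

abbreviation "past S t \<equiv> S \<inter> {1..<t}"

definition z :: "nat set \<Rightarrow> nat \<Rightarrow> real" where
  "z S t = inv_ip d (Mmat C x (past S t)) (x t) (x t)"

definition D :: "nat set \<Rightarrow> nat \<Rightarrow> real" where
  "D S t = (etat eta)\<^sup>2 * min 1 (z S t)"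

definition p :: "nat set \<Rightarrow> nat \<Rightarrow> real" where
  "p S t = min 1 (alpha * D S t)"

definition Z :: "nat set \<Rightarrow> (nat \<Rightarrow> real) \<Rightarrow> nat \<Rightarrow> real" where
  "Z S \<xi> t = (\<Sum>s\<in>past S t. noise_weight d C x (past S t) t s * \<xi> s)"

lemma D_eq: "delta d C eta x (past S t) t = D S t"
  by (simp add: delta_eq D_def z_def)

lemma p_eq: "query_prob d C eta alpha x (past S t) t = p S t"
  unfolding query_prob_def D_eq p_def ..

lemma z_nonneg: "0 \<le> z S t"
  unfolding z_def by (rule inv_ip_Mmat_nonneg) (simp_all add: C)

lemma D_nonneg: "0 \<le> D S t"
  by (simp add: D_def z_nonneg)

lemma p_bounds: "0 \<le> p S t" "p S t \<le> 1"
  using alpha by (simp_all add: p_def D_nonneg)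

lemma ln_exp_1_add_ge_1: "0 \<le> a \<Longrightarrow> 1 \<le> ln (exp 1 + a :: real)"
  by (simp add: ln_ge_iff add_pos_nonneg)

lemma L_summands: "1 \<le> ln (exp 1 + real T)" "1 \<le> ln (exp 1 + 1 / \<delta>)" "1 \<le> ln (exp 1 + C)"
  using C \<delta> by (auto intro!: ln_exp_1_add_ge_1)

lemma L_ge_3: "3 \<le> L"
  using L_summands by (simp add: L_def)

text \<open>The argument is the Markov level: at most \<open>4 * T\<close> exponentials and failure
  probability \<open>\<delta>\<close>.\<close>

lemma ln_confidence_le: "ln (4 * real T / \<delta>) \<le> 2 * L"
proof -
  have "ln (4 * real T / \<delta>) = ln 4 + ln (real T) + ln (1 / \<delta>)"
    using T \<delta> by (simp add: ln_mult ln_div)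
  moreover have "ln (4::real) \<le> 2"
  proof -
    have "ln (4::real) = 2 * ln 2" using ln_realpow[of 2 2] by simp
    then show ?thesis using ln_2_less_1 by simp
  qed
  moreover have "ln (real T) \<le> ln (exp 1 + real T)"
    using T by (subst ln_le_cancel_iff) (auto intro: add_pos_nonneg)
  moreover have "ln (1 / \<delta>) \<le> ln (exp 1 + 1 / \<delta>)"
    using \<delta> by (subst ln_le_cancel_iff) (auto intro: add_pos_nonneg)
  ultimately show ?thesis using L_summands unfolding L_def by argo
qed

lemma ln_potential_le: "ln (1 + C\<^sup>2 * T) + 1 \<le> 3 * L"
proof -
  have "1 + C\<^sup>2 * T \<le> (exp 1 + C)\<^sup>2 * (exp 1 + T)"
  proof -
    have "1 \<le> (exp 1 + C)\<^sup>2" "C\<^sup>2 \<le> (exp 1 + C)\<^sup>2"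
      using C by (auto intro!: one_le_power power_mono add_increasing2)
    then have "1 * 1 + C\<^sup>2 * T \<le> (exp 1 + C)\<^sup>2 * exp 1 + (exp 1 + C)\<^sup>2 * T"
      by (intro add_mono mult_mono mult_right_mono) auto
    then show ?thesis by (simp add: distrib_left)
  qed
  then have "ln (1 + C\<^sup>2 * T) \<le> ln ((exp 1 + C)\<^sup>2 * (exp 1 + T))"
    using C by (intro ln_mono) (auto intro!: add_pos_nonneg)
  also have "\<dots> = 2 * ln (exp 1 + C) + ln (exp 1 + T)"
  proof -
    have "exp 1 + C > 0" "exp 1 + real T > 0" using C by (simp_all add: add_pos_nonneg)
    then show ?thesis by (simp add: ln_mult ln_realpow)
  qed
  finally show ?thesis using L_summands unfolding L_def by argo
qed

lemma I_subset: "u \<in> {1..m} \<Longrightarrow> I u \<subseteq> {1..T}"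
  using I_cover by blast

lemma I_finite: "u \<in> {1..m} \<Longrightarrow> finite (I u)"
  using I_subset finite_subset by blast

lemma sum_I: "(\<Sum>t\<in>{1..T}. f t) = (\<Sum>u=1..m. \<Sum>t\<in>I u. f t)" for f :: "nat \<Rightarrow> real"
  unfolding I_cover[symmetric] using I_finite I_disjoint by (intro sum.UNION_disjoint) auto

text \<open>Keeps the number of block events in the union bound linear in \<open>T\<close>.\<close>

lemma m_le_T: "m \<le> T"
proof -
  have "m = (\<Sum>u=1..m. 1)" by simp
  also have "\<dots> \<le> (\<Sum>u=1..m. card (I u))"
    using I_finite I_nonempty by (intro sum_mono) (simp add: Suc_leI card_gt_0_iff)
  also have "\<dots> = card (\<Union>u\<in>{1..m}. I u)"
    using I_finite I_disjoint by (intro card_UN_disjoint[symmetric]) auto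
  also have "\<dots> = T" unfolding I_cover by simp
  finally show ?thesis .
qed

text \<open>The event passes from the probability-weighted uncertainty to the uncertainty actually
  queried, which the elliptic potential of the block bounds.\<close>

lemma sum_p_D_le:
  assumes u: "u \<in> {1..m}" and S: "S \<subseteq> {1..T}"
    and event: "(\<Sum>t\<in>I u. p S t * min 1 (z S t) / 2 - of_bool (t \<in> S) * min 1 (z S t)) \<le> 2 * L"
  shows "(\<Sum>t\<in>I u. p S t * D S t) \<le> 16 * (etat eta)\<^sup>2 * real (du u) * L"
proof (cases "du u = 0")
  case True
  \<comment> \<open>A zero-dimensional block contains only zero vectors. It is treated apart because
    additive constants can be absorbed only into a positive dimension.\<close>
  have "D S t = 0" if "t \<in> I u" for t
  proof -
    have "\<forall>i<d. x t i = 0"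
      using I_subspace[OF u] that True by (auto simp: in_subspace_dim_def)
    then show ?thesis by (simp add: D_def z_def inv_ip_def ip_def)
  qed
  then show ?thesis using True by simp
next
  case False
  have "finite S" using S finite_subset by blast
  have "(\<Sum>t\<in>I u. of_bool (t \<in> S) * min 1 (z S t)) = (\<Sum>t\<in>I u \<inter> S. min 1 (z S t))"
    by (subst sum.inter_restrict[OF I_finite[OF u]]) (auto intro!: sum.cong)
  also have "\<dots> \<le> 2 * (du u * ln (1 + C\<^sup>2 * T) + 1)"
    unfolding z_def using x I_subset[OF u]
    by (intro subspace_potential[OF I_subspace[OF u] I_subset[OF u] C T \<open>finite S\<close>]) auto
  also have "\<dots> \<le> 2 * (du u * (3 * L))"
  proof -
    have "du u * ln (1 + C\<^sup>2 * T) + 1 \<le> du u * (ln (1 + C\<^sup>2 * T) + 1)"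
      using False by (simp add: distrib_left)
    also have "\<dots> \<le> du u * (3 * L)" by (intro mult_left_mono ln_potential_le) simp
    finally show ?thesis by simp
  qed
  finally have "(\<Sum>t\<in>I u. of_bool (t \<in> S) * min 1 (z S t)) \<le> 6 * (du u * L)" by simp
  moreover have "L \<le> du u * L" using False L_ge_3 by (simp add: mult_le_cancel_right1)
  moreover have "(\<Sum>t\<in>I u. p S t * min 1 (z S t)) / 2 \<le> 2 * L + (\<Sum>t\<in>I u. of_bool (t \<in> S) * min 1 (z S t))"
    using event by (simp add: sum_subtractf sum_divide_distrib)
  \<comment> \<open>Half of the sum is at most 2 L + 6 \<open>du u\<close> L, hence at most 8
    \<open>du u\<close> L as the dimension is at least 1.\<close>
  ultimately have "(\<Sum>t\<in>I u. p S t * min 1 (z S t)) \<le> 16 * (du u * L)" by linarith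
  then have "(etat eta)\<^sup>2 * (\<Sum>t\<in>I u. p S t * min 1 (z S t)) \<le> (etat eta)\<^sup>2 * (16 * (du u * L))"
    by (intro mult_left_mono) auto
  then show ?thesis by (simp add: D_def sum_distrib_left mult_ac)
qed

section \<open>Query and regret bounds assembled from the blocks\<close>

lemma sqrt_L_le: "sqrt L \<le> L"
  using L_ge_3 by (intro real_le_lsqrt) (auto simp: power2_eq_square mult_le_cancel_left1)

lemma sum_p_le:
  assumes u: "u \<in> {1..m}" and "(\<Sum>t\<in>I u. p S t * D S t) \<le> 16 * (etat eta)\<^sup>2 * real (du u) * L"
  shows "(\<Sum>t\<in>I u. p S t) \<le> 4 * L * min (real (card (I u))) (etat eta * sqrt (alpha * real (du u) * real (card (I u))))"
proof -
  have e: "etat eta > 0" using etat_ge_1[of eta] by simp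
  have "(\<Sum>t\<in>I u. p S t) \<le> sqrt (real (card (I u)) * (alpha * (16 * (etat eta)\<^sup>2 * real (du u) * L)))"
    unfolding p_def using assms(2) alpha D_nonneg by (intro sum_min_le(1)) (auto simp: p_def)
  also have "real (card (I u)) * (alpha * (16 * (etat eta)\<^sup>2 * real (du u) * L)) = 16 * (etat eta)\<^sup>2 * L * (alpha * real (du u) * real (card (I u)))"
    by simp
  also have "sqrt \<dots> = 4 * etat eta * sqrt L * sqrt (alpha * real (du u) * real (card (I u)))"
    using e by (simp add: real_sqrt_mult)
  also have "\<dots> \<le> 4 * etat eta * L * sqrt (alpha * real (du u) * real (card (I u)))"
    using e alpha by (intro mult_right_mono mult_left_mono sqrt_L_le) auto
  finally have 1: "(\<Sum>t\<in>I u. p S t) \<le> 4 * L * (etat eta * sqrt (alpha * real (du u) * real (card (I u))))"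
    by (simp add: mult_ac)
  have "(\<Sum>t\<in>I u. p S t) \<le> card (I u)"
    using sum_bounded_above[of "I u" "p S" 1] p_bounds by simp
  also have "\<dots> \<le> 4 * L * card (I u)"
    using L_ge_3 by (simp add: mult_le_cancel_right1)
  finally show ?thesis using 1 by (simp add: min_def)
qed

lemma sum_D_le:
  assumes u: "u \<in> {1..m}" and "(\<Sum>t\<in>I u. p S t * D S t) \<le> 16 * (etat eta)\<^sup>2 * real (du u) * L"
  shows "(\<Sum>t\<in>I u. D S t) \<le> 20 * L * max ((etat eta)\<^sup>2 * real (du u)) (etat eta * sqrt (real (du u) * real (card (I u)) / alpha))"
proof -
  have e: "etat eta > 0" using etat_ge_1[of eta] by simp
  have "(\<Sum>t\<in>I u. D S t) \<le> 16 * (etat eta)\<^sup>2 * real (du u) * L + sqrt (real (card (I u)) * (16 * (etat eta)\<^sup>2 * real (du u) * L / alpha))"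
    using assms(2) alpha D_nonneg by (intro sum_min_le(2)) (auto simp: p_def)
  also have "real (card (I u)) * (16 * (etat eta)\<^sup>2 * real (du u) * L / alpha) = 16 * (etat eta)\<^sup>2 * L * (real (du u) * real (card (I u)) / alpha)"
    by simp
  also have "sqrt \<dots> = 4 * etat eta * sqrt L * sqrt (real (du u) * real (card (I u)) / alpha)"
    using e by (simp add: real_sqrt_mult real_sqrt_divide)
  also have "\<dots> \<le> 4 * etat eta * L * sqrt (real (du u) * real (card (I u)) / alpha)"
    using e alpha by (intro mult_right_mono mult_left_mono sqrt_L_le) auto
  also have "16 * (etat eta)\<^sup>2 * real (du u) * L + 4 * etat eta * L * sqrt (real (du u) * real (card (I u)) / alpha)
      = 16 * L * ((etat eta)\<^sup>2 * real (du u)) + 4 * L * (etat eta * sqrt (real (du u) * real (card (I u)) / alpha))"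
    by (simp add: mult_ac)
  \<comment> \<open>Bounding both terms by the maximum gives the constant 16 + 4 = 20.\<close>
  also have "\<dots> \<le> 16 * L * max ((etat eta)\<^sup>2 * real (du u)) (etat eta * sqrt (real (du u) * real (card (I u)) / alpha))
      + 4 * L * max ((etat eta)\<^sup>2 * real (du u)) (etat eta * sqrt (real (du u) * real (card (I u)) / alpha))"
    using L_ge_3 by (intro add_mono mult_left_mono) auto
  finally show ?thesis by simp
qed

text \<open>The event bounds the number of queries by twice the sum of their probabilities plus 2 L.
  The blocks contribute 2 * 4 L, and 8 L also covers the additive term.\<close>

lemma query_bound:
  assumes S: "S \<subseteq> {1..T}"
    and V: "\<And>u. u \<in> {1..m} \<Longrightarrow> (\<Sum>t\<in>I u. p S t * D S t) \<le> 16 * (etat eta)\<^sup>2 * real (du u) * L"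
    and event: "(\<Sum>t\<in>{1..T}. of_bool (t \<in> S) - 2 * p S t) \<le> 2 * L"
  shows "card S \<le> 8 * L * ((\<Sum>u=1..m. min (real (card (I u))) (etat eta * sqrt (alpha * real (du u) * real (card (I u))))) + 1)"
proof -
  have "real (card S) = (\<Sum>t\<in>{1..T}. of_bool (t \<in> S))"
    using S by (simp add: Int_absorb1 flip: sum.inter_restrict)
  then have "real (card S) \<le> 2 * (\<Sum>t\<in>{1..T}. p S t) + 2 * L"
    using event by (simp add: sum_subtractf sum_distrib_left)
  also have "(\<Sum>t\<in>{1..T}. p S t) \<le> (\<Sum>u=1..m. 4 * L * min (real (card (I u))) (etat eta * sqrt (alpha * real (du u) * real (card (I u)))))"
    unfolding sum_I using V by (intro sum_mono sum_p_le) auto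
  finally show ?thesis using L_ge_3 by (simp add: sum_distrib_left[symmetric] distrib_left)
qed

text \<open>Applying \<open>prediction_error\<close> with \<open>\<Gamma>\<close> equal to 3 L gives
  36 L^2 times the uncertainties, whose block sums contribute 20 L; hence 720 L^3.\<close>

lemma regret_bound:
  assumes S: "S \<subseteq> {1..T}"
    and V: "\<And>u. u \<in> {1..m} \<Longrightarrow> (\<Sum>t\<in>I u. p S t * D S t) \<le> 16 * (etat eta)\<^sup>2 * real (du u) * L"
    and noise: "\<And>t. t \<in> {1..T} \<Longrightarrow> \<bar>Z S \<xi> t\<bar> \<le> 3 * L * (etat eta * sqrt (z S t))"
  shows "(\<Sum>t=1..T. (clip (\<Sum>s\<in>past S t. noise_weight d C x (past S t) t s * (ip d theta (x s) + \<xi> s))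
      - ip d theta (x t))\<^sup>2)
    \<le> 720 * L ^ 3 * (\<Sum>u=1..m. max ((etat eta)\<^sup>2 * real (du u)) (etat eta * sqrt (real (du u) * real (card (I u)) / alpha)))"
proof -
  have "(\<Sum>t=1..T. (clip (\<Sum>s\<in>past S t. noise_weight d C x (past S t) t s * (ip d theta (x s) + \<xi> s))
      - ip d theta (x t))\<^sup>2) \<le> (\<Sum>t\<in>{1..T}. 4 * (3 * L)\<^sup>2 * D S t)"
  proof (rule sum_mono)
    fix t assume t: "t \<in> {1..T}"
    show "(clip (\<Sum>s\<in>past S t. noise_weight d C x (past S t) t s * (ip d theta (x s) + \<xi> s))
      - ip d theta (x t))\<^sup>2 \<le> 4 * (3 * L)\<^sup>2 * D S t"
      unfolding D_eq[symmetric] using noise[OF t] L_ge_3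
      by (intro prediction_error C theta theta_x t) (auto simp: z_def Z_def)
  qed
  also have "\<dots> = 36 * L\<^sup>2 * (\<Sum>u=1..m. \<Sum>t\<in>I u. D S t)"
    by (simp add: sum_distrib_left[symmetric] power_mult_distrib sum_I[unfolded One_nat_def])
  also have "\<dots> \<le> 36 * L\<^sup>2 * (\<Sum>u=1..m. 20 * L * max ((etat eta)\<^sup>2 * real (du u)) (etat eta * sqrt (real (du u) * real (card (I u)) / alpha)))"
    using V by (intro mult_left_mono sum_mono sum_D_le) auto
  finally show ?thesis
    by (simp add: sum_distrib_left[symmetric] power2_eq_square power3_eq_cube mult_ac)
qed

end

section \<open>Probability of the good event\<close>

context qufur
begin

text \<open>Index \<open>0\<close> serves the upper tail of the number of queries, an index \<open>u \<ge> 1\<close> the lower tail of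
  the queried uncertainty in \<open>I u\<close>.\<close>
definition drift :: "nat \<Rightarrow> nat \<Rightarrow> nat set \<Rightarrow> bool \<Rightarrow> real" where
  "drift u t R b =
    (if u = 0 then of_bool b - 2 * query_prob d C eta alpha x R t
     else if t \<in> I u then query_prob d C eta alpha x R t * min 1 (inv_ip d (Mmat C x R) (x t) (x t)) / 2
       - of_bool b * min 1 (inv_ip d (Mmat C x R) (x t) (x t))
     else 0)"

text \<open>Normalised so that the noise combination has variance proxy at most 1. Extension by zero
  outside the past lets the sum range over all rounds, as in the union bound.\<close>

definition scaled_weight :: "nat \<Rightarrow> nat set \<Rightarrow> nat \<Rightarrow> real" where
  "scaled_weight t S s =
    (if s \<in> past S t then noise_weight d C x (past S t) t s / (etat eta * sqrt (z S t)) else 0)"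

lemma drift_supermartingale:
  assumes "finite R"
  shows "query_prob d C eta alpha x R t * exp (drift u t R True)
      + (1 - query_prob d C eta alpha x R t) * exp (drift u t R False) \<le> 1"
  unfolding drift_def
  using upper_tail_drift[OF query_prob_bounds(1)[OF assms C alpha, of d eta x t]]
    lower_tail_drift[OF query_prob_bounds[OF assms C alpha, of d eta x t],
      of "min 1 (inv_ip d (Mmat C x R) (x t) (x t))"] inv_ip_Mmat_nonneg[OF assms C, of d x "x t"]
  by auto

lemma drift_0: "(\<Sum>t\<in>{1..T}. drift 0 t (past S t) (t \<in> S)) = (\<Sum>t\<in>{1..T}. of_bool (t \<in> S) - 2 * p S t)"
  unfolding drift_def by (simp only: p_eq simp_thms if_True)

lemma drift_pos:
  assumes u: "u \<in> {1..m}"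
  shows "(\<Sum>t\<in>{1..T}. drift u t (past S t) (t \<in> S)) =
    (\<Sum>t\<in>I u. p S t * min 1 (z S t) / 2 - of_bool (t \<in> S) * min 1 (z S t))"
proof -
  have "u \<noteq> 0" "{1..T} \<inter> I u = I u" using u I_subset[OF u] by auto
  have "(\<Sum>t\<in>{1..T}. drift u t (past S t) (t \<in> S)) =
    (\<Sum>t\<in>{1..T}. if t \<in> I u then p S t * min 1 (z S t) / 2 - of_bool (t \<in> S) * min 1 (z S t) else 0)"
    unfolding drift_def p_eq z_def[symmetric] using \<open>u \<noteq> 0\<close> by simp
  also have "\<dots> = (\<Sum>t\<in>{1..T} \<inter> I u. p S t * min 1 (z S t) / 2 - of_bool (t \<in> S) * min 1 (z S t))"
    by (rule sum.inter_restrict[symmetric]) simp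
  finally show ?thesis unfolding \<open>{1..T} \<inter> I u = I u\<close> .
qed

lemma sum_past:
  fixes f :: "nat \<Rightarrow> real"
  assumes "S \<subseteq> {1..T}"
  shows "(\<Sum>s\<in>{1..T}. if s \<in> past S t then f s else 0) = (\<Sum>s\<in>past S t. f s)"
proof -
  have "{1..T} \<inter> past S t = past S t" using assms by auto
  then show ?thesis by (subst sum.inter_restrict[symmetric]) auto
qed

lemma scaled_weight_sum_le:
  assumes "S \<subseteq> {1..T}"
  shows "eta\<^sup>2 * (\<Sum>s\<in>{1..T}. (scaled_weight t S s)\<^sup>2) \<le> 1"
proof -
  have e: "etat eta > 0" "eta\<^sup>2 \<le> (etat eta)\<^sup>2"
    using eta by (auto simp: etat_def intro!: power_mono)
  have "(\<Sum>s\<in>{1..T}. (scaled_weight t S s)\<^sup>2) =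
      (\<Sum>s\<in>past S t. (noise_weight d C x (past S t) t s / (etat eta * sqrt (z S t)))\<^sup>2)"
    unfolding sum_past[OF assms, symmetric] scaled_weight_def by (intro sum.cong) auto
  also have "\<dots> = (\<Sum>s\<in>past S t. (noise_weight d C x (past S t) t s)\<^sup>2) / ((etat eta)\<^sup>2 * z S t)"
    using z_nonneg by (simp add: power_divide power_mult_distrib sum_divide_distrib)
  also have "\<dots> \<le> z S t / ((etat eta)\<^sup>2 * z S t)"
    using noise_weight_sum_le[of "past S t" C d x t] C z_nonneg[of S t]
    by (intro divide_right_mono) (auto simp: z_def)
  also have "\<dots> \<le> 1 / (etat eta)\<^sup>2" by simp
  finally have "eta\<^sup>2 * (\<Sum>s\<in>{1..T}. (scaled_weight t S s)\<^sup>2) \<le> eta\<^sup>2 * (1 / (etat eta)\<^sup>2)"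
    by (intro mult_left_mono) auto
  also have "\<dots> \<le> 1" using e by simp
  finally show ?thesis .
qed

lemma scaled_weight_sum_eq:
  assumes "S \<subseteq> {1..T}"
  shows "(\<Sum>s\<in>{1..T}. scaled_weight t S s * \<xi> s) * (etat eta * sqrt (z S t)) = Z S \<xi> t"
proof -
  have "(\<Sum>s\<in>{1..T}. scaled_weight t S s * \<xi> s) =
      (\<Sum>s\<in>past S t. noise_weight d C x (past S t) t s / (etat eta * sqrt (z S t)) * \<xi> s)"
    unfolding sum_past[OF assms, symmetric] scaled_weight_def by (intro sum.cong) auto
  also have "\<dots> = Z S \<xi> t / (etat eta * sqrt (z S t))"
    by (simp add: Z_def sum_divide_distrib)
  finally have eq: "(\<Sum>s\<in>{1..T}. scaled_weight t S s * \<xi> s) = Z S \<xi> t / (etat eta * sqrt (z S t))" .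
  show ?thesis
  proof (cases "z S t = 0")
    \<comment> \<open>If \<open>z\<close> is zero, division by zero makes every scaled weight 0.
      This is consistent because all the original weights then vanish too.\<close>
    case True
    then have "(\<Sum>s\<in>past S t. (noise_weight d C x (past S t) t s)\<^sup>2) \<le> 0"
      using noise_weight_sum_le[of "past S t" C d x t] C by (simp add: z_def)
    then have "(\<Sum>s\<in>past S t. (noise_weight d C x (past S t) t s)\<^sup>2) = 0"
      by (intro antisym sum_nonneg) auto
    then have "\<forall>s\<in>past S t. noise_weight d C x (past S t) t s = 0"
      by (subst (asm) sum_nonneg_eq_0_iff) auto
    then show ?thesis using True by (simp add: Z_def)
  next
    case False
    then show ?thesis using etat_ge_1[of eta] unfolding eq by simp
  qed
qed

text \<open>The two claims with explicit constants, before they are weakened to the common form of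
  the theorem.\<close>

definition good :: "omega \<Rightarrow> bool" where
  "good \<omega> \<longleftrightarrow>
    real (query_complexity d C eta alpha x (snd \<omega>) T)
      \<le> 8 * L * ((\<Sum>u=1..m. min (real (card (I u))) (etat eta * sqrt (alpha * real (du u) * real (card (I u))))) + 1) \<and>
    regret d C eta alpha x (snd \<omega>) (\<lambda>t. ip d theta (x t) + fst \<omega> t) theta T
      \<le> 720 * L ^ 3 * (\<Sum>u=1..m. max ((etat eta)\<^sup>2 * real (du u)) (etat eta * sqrt (real (du u) * real (card (I u)) / alpha)))"

text \<open>The event is a finite union over the possible queried sets; on each piece the regret is
  a clipped polynomial expression in the noise with constant coefficients.\<close>

lemma sets_query_regret:
  assumes M: "noise_model M eta T"
  shows "{\<omega> \<in> space M. real (query_complexity d C eta alpha x (snd \<omega>) T) \<le> b \<and>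
    regret d C eta alpha x (snd \<omega>) (\<lambda>t. ip d theta (x t) + fst \<omega> t) theta T \<le> b'} \<in> sets M"
proof -
  let ?Q = "\<lambda>\<omega>. qset d C eta alpha x (snd \<omega>) T"
  define r where "r S \<omega> = (\<Sum>t=1..T. (clip (\<Sum>s\<in>past S t. noise_weight d C x (past S t) t s
      * (ip d theta (x s) + fst \<omega> s)) - ip d theta (x t))\<^sup>2)" for S and \<omega> :: omega
  have noise: "(\<lambda>\<omega>. fst \<omega> t) \<in> borel_measurable M" and coin: "(\<lambda>\<omega>. snd \<omega> t) \<in> borel_measurable M"
    if "t \<in> {1..T}" for t
    using M that by (auto simp: noise_model_def)
  have Q: "{\<omega> \<in> space M. ?Q \<omega> = S} \<in> sets M" if "S \<in> Pow {1..T}" for S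
  proof -
    have "{\<omega> \<in> space M. ?Q \<omega> = S} = {\<omega> \<in> space M. \<forall>t\<in>{1..T}. snd \<omega> t < p S t \<longleftrightarrow> t \<in> S}"
      using qset_eq_iff[of d C eta alpha x _ T S, unfolded p_eq] that by (simp add: Int_absorb2)
    also have "\<dots> \<in> sets M"
    proof (rule sets.sets_Collect_finite_All')
      fix t assume "t \<in> {1..T}"
      note [measurable] = coin[OF this]
      show "{\<omega> \<in> space M. snd \<omega> t < p S t \<longleftrightarrow> t \<in> S} \<in> sets M" by measurable
    qed (use T in auto)
    finally show ?thesis .
  qed
  have r: "r S \<in> borel_measurable M" if "S \<in> Pow {1..T}" for S
    unfolding r_def clip_def using that
    by (intro borel_measurable_sum borel_measurable_power borel_measurable_diff borel_measurable_min
        borel_measurable_max borel_measurable_times borel_measurable_add noise) auto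
  have "{\<omega> \<in> space M. real (query_complexity d C eta alpha x (snd \<omega>) T) \<le> b \<and>
      regret d C eta alpha x (snd \<omega>) (\<lambda>t. ip d theta (x t) + fst \<omega> t) theta T \<le> b'}
    = (\<Union>S\<in>{S \<in> Pow {1..T}. card S \<le> b}. {\<omega> \<in> space M. ?Q \<omega> = S} \<inter> {\<omega> \<in> space M. r S \<omega> \<le> b'})"
    using qset_subset[of d C eta alpha x _ T]
    by (auto simp: regret_eq[OF C] r_def query_complexity_def)
  also have "\<dots> \<in> sets M"
  proof (intro sets.finite_UN sets.Int Q)
    fix S assume "S \<in> {S \<in> Pow {1..T}. real (card S) \<le> b}"
    then have [measurable]: "r S \<in> borel_measurable M" using r by simp
    show "{\<omega> \<in> space M. r S \<omega> \<le> b'} \<in> sets M" by measurable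
  qed auto
  finally show ?thesis .
qed

lemma prob_good:
  assumes M: "noise_model M eta T"
  shows "1 - \<delta> \<le> measure M {\<omega> \<in> space M. good \<omega>}"
proof -
  \<comment> \<open>Two signs per round for the noise and the drift indices 0 to \<open>m\<close>:
    at most 2 T + m + 1, hence at most 4 T, exponentials.\<close>
  define J :: "(nat \<times> real + nat) set" where "J = Inl ` ({1..T} \<times> {1, -1}) \<union> Inr ` {0..m}"
  \<comment> \<open>The offset -1/2 compensates the sub-Gaussian moment of a combination with
    variance proxy at most 1.\<close>
  define a :: "nat \<times> real + nat \<Rightarrow> nat set \<Rightarrow> real" where
    "a = (\<lambda>k S. case k of Inl _ \<Rightarrow> - 1 / 2 | Inr u \<Rightarrow> \<Sum>t\<in>{1..T}. drift u t (past S t) (t \<in> S))"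
  define c :: "nat \<times> real + nat \<Rightarrow> nat set \<Rightarrow> nat \<Rightarrow> real" where
    "c = (\<lambda>k S s. case k of Inl (t, \<sigma>) \<Rightarrow> \<sigma> * scaled_weight t S s | Inr u \<Rightarrow> 0)"
  have "card J \<le> card ({1..T} \<times> {1, -1 :: real}) + card {0..m}"
    unfolding J_def by (intro order_trans[OF card_Un_le] add_mono card_image_le) auto
  also have "\<dots> \<le> 4 * T" using m_le_T T by (simp add: card_cartesian_product)
  finally have J: "card J \<le> 4 * T" .
  have r: "4 * real T / \<delta> > 0" using T \<delta> by simp
  have "1 - card J / (4 * real T / \<delta>) \<le> measure M {\<omega> \<in> space M. good \<omega>}"
  proof (rule exponential_union_bound[OF M C alpha _ r])
    show "finite J" by (simp add: J_def)
    show "{\<omega> \<in> space M. good \<omega>} \<in> sets M"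
      unfolding good_def by (rule sets_query_regret[OF M])
  next
    fix k assume k: "k \<in> J"
    show "(\<Sum>S\<in>Pow {1..T}. qset_prob d C eta alpha x T S
        * exp (a k S + eta\<^sup>2 / 2 * (\<Sum>s\<in>{1..T}. (c k S s)\<^sup>2))) \<le> 1"
    proof (cases k)
      case (Inl q)
      then obtain t \<sigma> where q: "k = Inl (t, \<sigma>)" "\<sigma>\<^sup>2 = 1" using k by (auto simp: J_def)
      have "exp (a k S + eta\<^sup>2 / 2 * (\<Sum>s\<in>{1..T}. (c k S s)\<^sup>2)) \<le> 1" if "S \<in> Pow {1..T}" for S
        using scaled_weight_sum_le[of S t] that q by (simp add: a_def c_def power_mult_distrib)
      then have "(\<Sum>S\<in>Pow {1..T}. qset_prob d C eta alpha x T S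
          * exp (a k S + eta\<^sup>2 / 2 * (\<Sum>s\<in>{1..T}. (c k S s)\<^sup>2))) \<le> (\<Sum>S\<in>Pow {1..T}. qset_prob d C eta alpha x T S)"
        using qset_prob_nonneg[OF C alpha] by (intro sum_mono mult_left_le) auto
      also have "\<dots> \<le> 1" by (rule sum_qset_prob_le_1[OF C alpha])
      finally show ?thesis .
    next
      case (Inr u)
      then show ?thesis
        using sum_qset_prob_exp_le_1[OF C alpha, where g = "drift u", OF drift_supermartingale] by (simp add: a_def c_def)
    qed
  next
    fix \<omega> assume \<omega>: "\<omega> \<in> space M"
    let ?Q = "qset d C eta alpha x (snd \<omega>) T"
    assume *: "\<And>k. k \<in> J \<Longrightarrow> a k ?Q + (\<Sum>s\<in>{1..T}. c k ?Q s * fst \<omega> s) \<le> ln (4 * real T / \<delta>)"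
    have bound: "a k ?Q + (\<Sum>s\<in>{1..T}. c k ?Q s * fst \<omega> s) \<le> 2 * L" if "k \<in> J" for k
      using *[OF that] ln_confidence_le by linarith
    have Q: "?Q \<subseteq> {1..T}" by (rule qset_subset)
    have "(\<Sum>t\<in>{1..T}. drift u t (past ?Q t) (t \<in> ?Q)) \<le> 2 * L" if "u \<in> {0..m}" for u
      using bound[of "Inr u"] that by (simp add: J_def a_def c_def)
    note dr = this
    have V: "(\<Sum>t\<in>I u. p ?Q t * D ?Q t) \<le> 16 * (etat eta)\<^sup>2 * real (du u) * L" if u: "u \<in> {1..m}" for u
      using dr[of u] u by (intro sum_p_D_le[OF u Q]) (simp add: drift_pos[OF u, symmetric])
    have noise: "\<bar>Z ?Q (fst \<omega>) t\<bar> \<le> 3 * L * (etat eta * sqrt (z ?Q t))" if t: "t \<in> {1..T}" for t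
    proof -
      define N where "N = (\<Sum>s\<in>{1..T}. scaled_weight t ?Q s * fst \<omega> s)"
      \<comment> \<open>The bound reads -1/2 + \<open>\<sigma> * N\<close> \<le> 2 L, and 1/2 is at
        most L. Both signs together control the absolute value.\<close>
      have "\<sigma> * N \<le> 3 * L" if "\<sigma> \<in> {1, -1}" for \<sigma>
        using bound[of "Inl (t, \<sigma>)"] t that L_ge_3
        by (auto simp: J_def a_def c_def N_def mult.assoc sum_distrib_left[symmetric] sum_negf)
      from this[of 1] this[of "-1"] have "\<bar>N\<bar> \<le> 3 * L" by simp
      then have "\<bar>N\<bar> * (etat eta * sqrt (z ?Q t)) \<le> 3 * L * (etat eta * sqrt (z ?Q t))"
        using etat_ge_1[of eta] z_nonneg by (intro mult_right_mono) auto
      moreover have "\<bar>Z ?Q (fst \<omega>) t\<bar> = \<bar>N\<bar> * (etat eta * sqrt (z ?Q t))"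
        using scaled_weight_sum_eq[OF Q, of t "fst \<omega>"] etat_ge_1[of eta] z_nonneg[of ?Q t]
        by (simp add: N_def abs_mult flip: scaled_weight_sum_eq[OF Q, of t "fst \<omega>"])
      ultimately show ?thesis by simp
    qed
    have "good \<omega>"
      unfolding good_def query_complexity_def regret_eq[OF C]
      using dr[of 0, unfolded drift_0] by (intro conjI query_bound[OF Q V] regret_bound[OF Q V noise]) simp_all
    then show "\<omega> \<in> {\<omega> \<in> space M. good \<omega>}" using \<omega> by simp
  qed
  moreover have "card J / (4 * real T / \<delta>) \<le> \<delta>"
  proof -
    have "real (card J) \<le> 4 * real T" using J by linarith
    then show ?thesis using T \<delta> by (simp add: field_simps)
  qed
  ultimately show ?thesis by linarith
qed

text \<open>A single constant must serve as both factor and exponent. The value 720 covers both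
  factors, and enlarging the exponents 1 and 3 is harmless because L is at least 1.\<close>

lemma prob_query_regret:
  assumes M: "noise_model M eta T"
  shows "1 - \<delta> \<le> measure M {\<omega> \<in> space M.
    real (query_complexity d C eta alpha x (snd \<omega>) T)
      \<le> 720 * L powr 720 * ((\<Sum>u=1..m. min (real (card (I u))) (etat eta * sqrt (alpha * real (du u) * real (card (I u))))) + 1) \<and>
    regret d C eta alpha x (snd \<omega>) (\<lambda>t. ip d theta (x t) + fst \<omega> t) theta T
      \<le> 720 * L powr 720 * (\<Sum>u=1..m. max ((etat eta)\<^sup>2 * real (du u)) (etat eta * sqrt (real (du u) * real (card (I u)) / alpha)))}"
    (is "_ \<le> measure M {\<omega> \<in> space M. ?q \<omega> \<le> _ * ?b \<and> ?r \<omega> \<le> _ * ?b'}")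
proof -
  interpret prob_space M using M by (simp add: noise_model_def)
  have "L powr 1 \<le> L powr 720" "L powr 3 \<le> L powr 720"
    by (rule powr_mono, simp, use L_ge_3 in simp)+
  moreover have "L powr 1 = L" "L powr 3 = L ^ 3"
    using L_ge_3 by (simp_all add: powr_numeral)
  ultimately have "8 * L \<le> 720 * L powr 720" "720 * L ^ 3 \<le> 720 * L powr 720"
    using L_ge_3 by linarith+
  moreover have "0 \<le> ?b" "0 \<le> ?b'"
    using etat_ge_1[of eta] alpha by (auto intro!: sum_nonneg add_nonneg_nonneg simp: max.coboundedI1)
  ultimately have "8 * L * ?b \<le> 720 * L powr 720 * ?b" "720 * L ^ 3 * ?b' \<le> 720 * L powr 720 * ?b'"
    by - (rule mult_right_mono; assumption)+
  then have "prob {\<omega> \<in> space M. good \<omega>} \<le> prob {\<omega> \<in> space M. ?q \<omega> \<le> 720 * L powr 720 * ?b \<and> ?r \<omega> \<le> 720 * L powr 720 * ?b'}"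
    by (intro finite_measure_mono sets_query_regret[OF M]) (auto simp: good_def)
  then show ?thesis using prob_good[OF M] by linarith
qed

end

theorem theorem1:
  "\<exists>K::real. K > 0 \<and>
   (\<forall>(d::nat) (T::nat) (C::real) (eta::real) (\<delta>::real) (alpha::real)
      (theta::nat \<Rightarrow> real) (x::nat \<Rightarrow> nat \<Rightarrow> real)
      (m::nat) (I::nat \<Rightarrow> nat set) (du::nat \<Rightarrow> nat) (M::omega measure).
      d \<ge> 1 \<and> T \<ge> 1 \<and> C > 0 \<and> eta \<ge> 0 \<and> 0 < \<delta> \<and> \<delta> < 1 \<and> alpha > 0 \<and>
      sqrt (ip d theta theta) \<le> C \<and>
      (\<forall>t\<in>{1..T}. sqrt (ip d (x t) (x t)) \<le> 1 \<and> \<bar>ip d theta (x t)\<bar> \<le> 1) \<and>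
      (\<forall>u\<in>{1..m}. I u \<noteq> {}) \<and>
      (\<forall>u\<in>{1..m}. \<forall>v\<in>{1..m}. u \<noteq> v \<longrightarrow> I u \<inter> I v = {}) \<and>
      (\<Union>u\<in>{1..m}. I u) = {1..T} \<and>
      (\<forall>u\<in>{1..m}. in_subspace_dim d (du u) (x ` I u)) \<and>
      noise_model M eta T
      \<longrightarrow>
      measure M {\<omega> \<in> space M.
         (let U = snd \<omega>;
              y = (\<lambda>t. ip d theta (x t) + fst \<omega> t);
              L = ln (exp 1 + real T) + ln (exp 1 + 1 / \<delta>) + ln (exp 1 + C)
          in real (query_complexity d C eta alpha x U T)
               \<le> K * L powr K *
                 ((\<Sum>u=1..m. min (real (card (I u)))
                     (etat eta * sqrt (alpha * real (du u) * real (card (I u))))) + 1)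
             \<and> regret d C eta alpha x U y theta T
               \<le> K * L powr K *
                 (\<Sum>u=1..m. max ((etat eta)^2 * real (du u))
                     (etat eta * sqrt (real (du u) * real (card (I u)) / alpha))))}
      \<ge> 1 - \<delta>)"
proof (rule exI[of _ 720], intro conjI allI impI; (elim conjE)?)
  fix d T :: nat and C eta \<delta> alpha :: real and theta :: "nat \<Rightarrow> real" and x :: "nat \<Rightarrow> nat \<Rightarrow> real"
    and m :: nat and I :: "nat \<Rightarrow> nat set" and du :: "nat \<Rightarrow> nat" and M :: "omega measure"
  assume *: "T \<ge> 1" "C > 0" "eta \<ge> 0" "0 < \<delta>" "\<delta> < 1" "alpha > 0"
      "sqrt (ip d theta theta) \<le> C"
      "\<forall>t\<in>{1..T}. sqrt (ip d (x t) (x t)) \<le> 1 \<and> \<bar>ip d theta (x t)\<bar> \<le> 1"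
      "\<forall>u\<in>{1..m}. I u \<noteq> {}"
      "\<forall>u\<in>{1..m}. \<forall>v\<in>{1..m}. u \<noteq> v \<longrightarrow> I u \<inter> I v = {}"
      "(\<Union>u\<in>{1..m}. I u) = {1..T}"
      "\<forall>u\<in>{1..m}. in_subspace_dim d (du u) (x ` I u)"
    and M: "noise_model M eta T"
  interpret qufur d T C eta \<delta> alpha theta x m I du
    using * by unfold_locales blast+
  show "1 - \<delta> \<le> measure M {\<omega> \<in> space M.
         (let U = snd \<omega>;
              y = (\<lambda>t. ip d theta (x t) + fst \<omega> t);
              L = ln (exp 1 + real T) + ln (exp 1 + 1 / \<delta>) + ln (exp 1 + C)
          in real (query_complexity d C eta alpha x U T)
               \<le> 720 * L powr 720 *
                 ((\<Sum>u=1..m. min (real (card (I u)))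
                     (etat eta * sqrt (alpha * real (du u) * real (card (I u))))) + 1)
             \<and> regret d C eta alpha x U y theta T
               \<le> 720 * L powr 720 *
                 (\<Sum>u=1..m. max ((etat eta)^2 * real (du u))
                     (etat eta * sqrt (real (du u) * real (card (I u)) / alpha))))}"
    unfolding Let_def L_def[symmetric] by (rule prob_query_regret[OF M])
qed simp

end
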